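(* Let $F$ be an algebraically closed field of transcendence degree at least $1$ (over its prime field), and let $H$ be a group of permutations of $F\cup\{\infty\}$ properly containing $P\Gamma L_2(F)$. Then $H$ is $4$-transitive, i.e. $H$ acts transitively on the set of $4$-tuples of distinct elements of $F\cup\{\infty\}$.
   Context: For a field $F$, $F\cup\{\infty\}$ is the projective line over $F$. $P\Gamma L_2(F)$ is the group of permutations of $F\cup\{\infty\}$ of the form $x\mapsto\frac{ax^\sigma+b}{cx^\sigma+d}$ with $a,b,c,d\in F$, $ad-bc\neq 0$, $\sigma\in\mathrm{Aut}(F)$ (the group of field automorphisms of $F$), where $x^\sigma=\sigma(x)$, $\infty^\sigma=\infty$, and the usual conventions for $\infty$ and fractions apply. *)

theory Defs
  imports
    "HOL-Algebra.Bij"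
    "HOL-Computational_Algebra.Polynomial"
    "HOL-Library.Extended_Nat"
    "HOL-Library.Poly_Mapping"
begin

definition field_automorphism :: "('a::field \<Rightarrow> 'a) \<Rightarrow> bool" where
  "field_automorphism \<sigma> \<longleftrightarrow> bij \<sigma> \<and> \<sigma> 1 = 1 \<and>
     (\<forall>x y. \<sigma> (x + y) = \<sigma> x + \<sigma> y) \<and> (\<forall>x y. \<sigma> (x * y) = \<sigma> x * \<sigma> y)"

definition is_subfield :: "'a::field set \<Rightarrow> bool" where
  "is_subfield K \<longleftrightarrow> 0 \<in> K \<and> 1 \<in> K \<and>
     (\<forall>x\<in>K. \<forall>y\<in>K. x + y \<in> K \<and> x * y \<in> K) \<and>
     (\<forall>x\<in>K. - x \<in> K \<and> inverse x \<in> K)"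

definition prime_field :: "'a::field set" where
  "prime_field = \<Inter>{K. is_subfield K}"

text \<open>
  A multivariate polynomial is a finitely supported map from monomials to coefficients, and a
  monomial is a finitely supported map from variables to exponents. To speak about algebraic
  relations between elements of the field, the variables are indexed by the field elements
  themselves, and the evaluation substitutes \<open>x\<close> for the variable with index \<open>x\<close>.
\<close>

type_synonym 'a mpolynomial = "('a \<Rightarrow>\<^sub>0 nat) \<Rightarrow>\<^sub>0 'a"

definition mpoly_over :: "'a::field set \<Rightarrow> 'a set \<Rightarrow> 'a mpolynomial \<Rightarrow> bool" where
  "mpoly_over K S p \<longleftrightarrow>
     (\<forall>m. Poly_Mapping.lookup p m \<in> K) \<and> (\<forall>m\<in>Poly_Mapping.keys p. Poly_Mapping.keys m \<subseteq> S)"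

definition mpoly_eval :: "'a::field mpolynomial \<Rightarrow> 'a" where
  "mpoly_eval p =
     (\<Sum>m\<in>Poly_Mapping.keys p. Poly_Mapping.lookup p m *
       (\<Prod>x\<in>Poly_Mapping.keys m. x ^ Poly_Mapping.lookup m x))"

definition algebraically_independent :: "'a::field set \<Rightarrow> 'a set \<Rightarrow> bool" where
  "algebraically_independent K S \<longleftrightarrow>
     (\<forall>p. mpoly_over K S p \<and> mpoly_eval p = 0 \<longrightarrow> p = 0)"

text \<open>
  The transcendence degree of the whole field \<open>'a\<close> over its subfield \<open>K\<close>; all infinite
  transcendence degrees are identified with \<open>\<infinity>\<close>.
\<close>

definition transcendence_degree :: "'a::field set \<Rightarrow> enat" where
  "transcendence_degree K =
     Sup {enat (card S) | S. finite S \<and> algebraically_independent K S}"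

text \<open>
  The projective line over \<open>'a\<close> is \<open>'a option\<close>, with \<open>None\<close> the point at infinity and
  \<open>Some x\<close> the point \<open>x\<close> of the field. In particular \<open>map_option \<sigma>\<close> is the extension of a
  field automorphism \<open>\<sigma>\<close> that fixes infinity.
\<close>

fun frac_linear :: "'a::field \<Rightarrow> 'a \<Rightarrow> 'a \<Rightarrow> 'a \<Rightarrow> 'a option \<Rightarrow> 'a option" where
  "frac_linear a b c d None = (if c = 0 then None else Some (a / c))"
| "frac_linear a b c d (Some x) =
     (if c * x + d = 0 then None else Some ((a * x + b) / (c * x + d)))"

definition PGammaL2 :: "('a::field option \<Rightarrow> 'a option) set" where
  "PGammaL2 = {frac_linear a b c d \<circ> map_option \<sigma> | a b c d \<sigma>.
     a * d - b * c \<noteq> 0 \<and> field_automorphism \<sigma>}"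

definition k_transitive :: "nat \<Rightarrow> ('b \<Rightarrow> 'b) set \<Rightarrow> bool" where
  "k_transitive k H \<longleftrightarrow>
     (\<forall>xs ys. length xs = k \<and> distinct xs \<and> length ys = k \<and> distinct ys \<longrightarrow>
       (\<exists>h\<in>H. map h xs = ys))"

end

theory Submission
  imports Defs
begin

text \<open>
  Fix a transcendental \<open>x\<close> and suppose that some quadruple of distinct points is not in the
  \<open>H\<close>-orbit of \<open>(\<infinity>, 0, 1, x)\<close>. Since \<open>Aut(F)\<close> is transitive on the elements that are transcendental
  over the prime field, such special quadruples have algebraic cross ratio. Closing \<open>{\<infinity>, 0, 1}\<close> under
  the rule that three members and a special fourth point give a member yields the projective line
  over a proper subfield \<open>k\<^sub>0\<close> with more than two elements. The rule is \<open>H\<close>-invariant, so \<open>H\<close>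
  permutes the images of this subline under \<open>PGL\<^sub>2(F)\<close>. Hence the stabilizer of \<open>\<infinity>\<close> and \<open>0\<close> in \<open>H\<close> preserves the \<open>k\<^sub>0\<close>-lines of \<open>F\<close>,
  and acts additively by the argument of the fundamental theorem of affine geometry. An element \<open>h\<close> of \<open>H\<close> that
  also fixes \<open>1\<close> is additive together with \<open>1 / h(1 / x)\<close>; by Hua's identity
  \<open>a - (a\<inverse> + (b\<inverse> - a)\<inverse>)\<inverse> = a b a\<close> it is a field automorphism, as every element of \<open>F\<close> is a
  square. So \<open>H\<close> is \<open>P\<Gamma>L\<^sub>2(F)\<close>.

  For the transitivity of \<open>Aut(F)\<close>, take a subring \<open>K\<close> maximal among those over which both \<open>x\<close> and
  \<open>y\<close> are transcendental. By maximality every \<open>z\<close> is algebraic over \<open>K[x]\<close> or \<open>K[y]\<close>, and \<open>z = x + y\<close>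
  shows that \<open>x\<close> and \<open>y\<close> are algebraically dependent over \<open>K\<close>. So a maximal partial isomorphism
  extending \<open>K[x] \<cong> K[y]\<close> has domain and range \<open>F\<close>.
\<close>

subsection \<open>Extension of partial isomorphisms\<close>

definition is_subring :: "'a::field set \<Rightarrow> bool" where
  "is_subring K \<longleftrightarrow> 1 \<in> K \<and> (\<forall>a\<in>K. \<forall>b\<in>K. a - b \<in> K \<and> a * b \<in> K)"

text \<open>Over a subring this is algebraicity over the field of fractions, since denominators can
  be cleared; so no inverses have to be adjoined.\<close>

definition algebraic_over :: "'a::field set \<Rightarrow> 'a \<Rightarrow> bool" where
  "algebraic_over K z \<longleftrightarrow> (\<exists>p. p \<noteq> 0 \<and> (\<forall>i. coeff p i \<in> K) \<and> poly p z = 0)"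

text \<open>
  A partial isomorphism is encoded by its graph, a subring of \<open>'a \<times> 'a\<close>. This makes the notion
  symmetric under converse and closed under unions of chains.
\<close>

definition partial_iso :: "('a::field \<times> 'a) set \<Rightarrow> bool" where
  "partial_iso \<Gamma> \<longleftrightarrow> (1, 1) \<in> \<Gamma> \<and>
     (\<forall>a b c d. (a, b) \<in> \<Gamma> \<longrightarrow> (c, d) \<in> \<Gamma> \<longrightarrow> (a - c, b - d) \<in> \<Gamma> \<and> (a * c, b * d) \<in> \<Gamma>) \<and>
     (\<forall>a b. (a, b) \<in> \<Gamma> \<longrightarrow> (a = 0 \<longleftrightarrow> b = 0))"

definition maximal_iso :: "('a::field \<times> 'a) set \<Rightarrow> bool" where
  "maximal_iso \<Gamma> \<longleftrightarrow> partial_iso \<Gamma> \<and> (\<forall>\<Delta>. partial_iso \<Delta> \<longrightarrow> \<Gamma> \<subseteq> \<Delta> \<longrightarrow> \<Delta> = \<Gamma>)"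

text \<open>The image of \<open>p\<close> under the isomorphism, kept as a relation: for the
  converse graph \<open>p\<close> and \<open>q\<close> just trade places.\<close>

definition poly_rel :: "('a::field \<times> 'a) set \<Rightarrow> 'a poly \<Rightarrow> 'a poly \<Rightarrow> bool" where
  "poly_rel \<Gamma> p q \<longleftrightarrow> (\<forall>i. (coeff p i, coeff q i) \<in> \<Gamma>)"

section \<open>Closure properties of subrings\<close>

lemma is_subring_0: "is_subring K \<Longrightarrow> 0 \<in> K"
  unfolding is_subring_def by (metis diff_self)

lemma is_subring_minus: "is_subring K \<Longrightarrow> a \<in> K \<Longrightarrow> - a \<in> K"
  using is_subring_0[of K] unfolding is_subring_def by (metis diff_0)

lemma is_subring_add: "is_subring K \<Longrightarrow> a \<in> K \<Longrightarrow> b \<in> K \<Longrightarrow> a + b \<in> K"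
  using is_subring_minus[of K b] unfolding is_subring_def
  by (metis diff_minus_eq_add)

lemma is_subring_mult: "is_subring K \<Longrightarrow> a \<in> K \<Longrightarrow> b \<in> K \<Longrightarrow> a * b \<in> K"
  unfolding is_subring_def by blast

lemma is_subring_sum:
  "is_subring K \<Longrightarrow> (\<And>i. i \<in> I \<Longrightarrow> f i \<in> K) \<Longrightarrow> sum f I \<in> K"
  by (induction I rule: infinite_finite_induct) (auto intro: is_subring_0 is_subring_add)

lemma is_subring_power: "is_subring K \<Longrightarrow> a \<in> K \<Longrightarrow> a ^ n \<in> K"
  by (induction n) (auto simp: is_subring_def)

lemma is_subring_poly:
  "is_subring K \<Longrightarrow> (\<And>i. coeff p i \<in> K) \<Longrightarrow> z \<in> K \<Longrightarrow> poly p z \<in> K"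
  unfolding poly_altdef
  by (rule is_subring_sum) (auto simp: is_subring_mult is_subring_power)

lemma is_subring_coeff_mult:
  assumes "is_subring K" "\<And>i. coeff p i \<in> K" "\<And>i. coeff q i \<in> K"
  shows "coeff (p * q) i \<in> K"
  unfolding coeff_mult using assms by (intro is_subring_sum) (auto simp: is_subring_def)

lemma is_subring_coeff_pcompose:
  assumes K: "is_subring K" and "\<And>i. coeff p i \<in> K" and q: "\<And>i. coeff q i \<in> K"
  shows "coeff (pcompose p q) i \<in> K"
  using assms(2)
proof (induction p arbitrary: i)
  case 0
  thus ?case using is_subring_0[OF K] by simp
next
  case (pCons a p)
  have "coeff p i \<in> K" for i using pCons.prems[of "Suc i"] by simp
  hence "coeff (pcompose p q) i \<in> K" for i using pCons.IH by blast
  moreover have "coeff [:a:] i \<in> K" for i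
    using pCons.prems[of 0] is_subring_0[OF K] by (simp add: coeff_pCons split: nat.split)
  ultimately show ?case
    unfolding pcompose_pCons coeff_add
    using is_subring_add[OF K] is_subring_coeff_mult[OF K] q by blast
qed

section \<open>Arithmetic of partial isomorphisms\<close>

lemma partial_iso_diff:
  "partial_iso \<Gamma> \<Longrightarrow> (a, b) \<in> \<Gamma> \<Longrightarrow> (c, d) \<in> \<Gamma> \<Longrightarrow> (a - c, b - d) \<in> \<Gamma>"
  and partial_iso_mult:
  "partial_iso \<Gamma> \<Longrightarrow> (a, b) \<in> \<Gamma> \<Longrightarrow> (c, d) \<in> \<Gamma> \<Longrightarrow> (a * c, b * d) \<in> \<Gamma>"
  and partial_iso_1: "partial_iso \<Gamma> \<Longrightarrow> (1, 1) \<in> \<Gamma>"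
  and partial_iso_eq_0: "partial_iso \<Gamma> \<Longrightarrow> (a, b) \<in> \<Gamma> \<Longrightarrow> a = 0 \<longleftrightarrow> b = 0"
  unfolding partial_iso_def by blast+

lemma partial_iso_0: "partial_iso \<Gamma> \<Longrightarrow> (0, 0) \<in> \<Gamma>"
  using partial_iso_diff[OF _ partial_iso_1 partial_iso_1] by fastforce

lemma partial_iso_add:
  assumes "partial_iso \<Gamma>" "(a, b) \<in> \<Gamma>" "(c, d) \<in> \<Gamma>"
  shows "(a + c, b + d) \<in> \<Gamma>"
  using partial_iso_diff[OF assms(1,2) partial_iso_diff[OF assms(1) partial_iso_0[OF assms(1)] assms(3)]]
  by simp

lemma partial_iso_sum:
  "partial_iso \<Gamma> \<Longrightarrow> (\<And>i. i \<in> I \<Longrightarrow> (f i, g i) \<in> \<Gamma>) \<Longrightarrow> (sum f I, sum g I) \<in> \<Gamma>"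
  by (induction I rule: infinite_finite_induct) (auto intro: partial_iso_0 partial_iso_add)

lemma partial_iso_converse: "partial_iso (\<Gamma>\<inverse>) \<longleftrightarrow> partial_iso \<Gamma>"
  unfolding partial_iso_def by auto

lemma maximal_iso_converse: "maximal_iso \<Gamma> \<Longrightarrow> maximal_iso (\<Gamma>\<inverse>)"
  unfolding maximal_iso_def
  by (metis converse_converse converse_mono partial_iso_converse)

lemma subring_Domain: "partial_iso \<Gamma> \<Longrightarrow> is_subring (Domain \<Gamma>)"
  unfolding is_subring_def by (auto dest: partial_iso_1 partial_iso_diff partial_iso_mult)

lemma partial_iso_unique:
  assumes "partial_iso \<Gamma>" "(a, b) \<in> \<Gamma>" "(a, c) \<in> \<Gamma>"
  shows "b = c"
  using partial_iso_diff[OF assms] partial_iso_eq_0[OF assms(1)] by fastforce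

section \<open>Polynomials related coefficientwise by a partial isomorphism\<close>

lemma poly_rel_diff:
  "partial_iso \<Gamma> \<Longrightarrow> poly_rel \<Gamma> p q \<Longrightarrow> poly_rel \<Gamma> p' q' \<Longrightarrow> poly_rel \<Gamma> (p - p') (q - q')"
  unfolding poly_rel_def by (auto intro: partial_iso_diff)

lemma poly_rel_add:
  "partial_iso \<Gamma> \<Longrightarrow> poly_rel \<Gamma> p q \<Longrightarrow> poly_rel \<Gamma> p' q' \<Longrightarrow> poly_rel \<Gamma> (p + p') (q + q')"
  unfolding poly_rel_def by (auto intro: partial_iso_add)

lemma poly_rel_mult:
  "partial_iso \<Gamma> \<Longrightarrow> poly_rel \<Gamma> p q \<Longrightarrow> poly_rel \<Gamma> p' q' \<Longrightarrow> poly_rel \<Gamma> (p * p') (q * q')"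
  unfolding poly_rel_def coeff_mult by (auto intro!: partial_iso_sum partial_iso_mult)

lemma poly_rel_monom:
  "partial_iso \<Gamma> \<Longrightarrow> (a, b) \<in> \<Gamma> \<Longrightarrow> poly_rel \<Gamma> (monom a n) (monom b n)"
  unfolding poly_rel_def by (auto intro: partial_iso_0)

lemma poly_rel_eq_0:
  assumes "partial_iso \<Gamma>" "poly_rel \<Gamma> p q"
  shows "p = 0 \<longleftrightarrow> q = 0"
  using assms partial_iso_eq_0 unfolding poly_rel_def poly_eq_iff coeff_0 by blast

lemma poly_rel_degree:
  assumes "partial_iso \<Gamma>" "poly_rel \<Gamma> p q"
  shows "degree p = degree q"
proof -
  have "coeff p i = 0 \<longleftrightarrow> coeff q i = 0" for i
    using assms partial_iso_eq_0 unfolding poly_rel_def by blast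
  hence "degree p \<le> degree q" "degree q \<le> degree p" using coeff_eq_0 by (blast intro!: degree_le)+
  thus ?thesis by simp
qed

text \<open>For a partial isomorphism \<open>\<Gamma>\<close> this is the subring of
  \<open>'a \<times> 'a\<close> generated by \<open>\<Gamma>\<close> and
  \<open>(z, w)\<close>.\<close>

definition adjoin_pair :: "('a::field \<times> 'a) set \<Rightarrow> 'a \<Rightarrow> 'a \<Rightarrow> ('a \<times> 'a) set" where
  "adjoin_pair \<Gamma> z w = {(poly p z, poly q w) | p q. poly_rel \<Gamma> p q}"

lemma subset_adjoin_pair: "partial_iso \<Gamma> \<Longrightarrow> \<Gamma> \<subseteq> adjoin_pair \<Gamma> z w"
proof (rule subrelI)
  fix a b assume "partial_iso \<Gamma>" "(a, b) \<in> \<Gamma>"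
  hence "poly_rel \<Gamma> (monom a 0) (monom b 0)" by (rule poly_rel_monom)
  thus "(a, b) \<in> adjoin_pair \<Gamma> z w"
    unfolding adjoin_pair_def by (force simp: poly_monom)
qed

lemma in_adjoin_pair: "partial_iso \<Gamma> \<Longrightarrow> (z, w) \<in> adjoin_pair \<Gamma> z w"
  using poly_rel_monom[OF _ partial_iso_1, of \<Gamma> 1]
  unfolding adjoin_pair_def by (force simp: poly_monom)

text \<open>The ring conditions hold for any \<open>z\<close> and \<open>w\<close>. Only the zero
  condition can fail; applied to differences, it says that the extension is well defined and
  injective.\<close>

lemma partial_iso_adjoin_pair:
  assumes "partial_iso \<Gamma>" "\<And>p q. poly_rel \<Gamma> p q \<Longrightarrow> poly p z = 0 \<longleftrightarrow> poly q w = 0"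
  shows "partial_iso (adjoin_pair \<Gamma> z w)"
  unfolding partial_iso_def
proof (intro conjI allI impI)
  show "(1, 1) \<in> adjoin_pair \<Gamma> z w"
    using subset_adjoin_pair[OF assms(1)] partial_iso_1[OF assms(1)] by blast
  fix a b assume "(a, b) \<in> adjoin_pair \<Gamma> z w"
  then obtain p q where pq: "poly_rel \<Gamma> p q" "a = poly p z" "b = poly q w"
    unfolding adjoin_pair_def by blast
  show "a = 0 \<longleftrightarrow> b = 0" using assms(2) pq by simp
  fix c d assume "(c, d) \<in> adjoin_pair \<Gamma> z w"
  then obtain p' q' where pq': "poly_rel \<Gamma> p' q'" "c = poly p' z" "d = poly q' w"
    unfolding adjoin_pair_def by blast
  show "(a - c, b - d) \<in> adjoin_pair \<Gamma> z w"
    using poly_rel_diff[OF assms(1) pq(1) pq'(1)] pq pq'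
    unfolding adjoin_pair_def by (metis (mono_tags, lifting) CollectI poly_diff)
  show "(a * c, b * d) \<in> adjoin_pair \<Gamma> z w"
    using poly_rel_mult[OF assms(1) pq(1) pq'(1)] pq pq'
    unfolding adjoin_pair_def by (metis (mono_tags, lifting) CollectI poly_mult)
qed

text \<open>Zorn's lemma: each closure condition involves at most two pairs, and these lie in a
  common member of the chain.\<close>

lemma ex_maximal_iso:
  assumes "partial_iso \<Gamma>"
  obtains \<Delta> where "\<Gamma> \<subseteq> \<Delta>" "maximal_iso \<Delta>"
proof -
  let ?A = "{\<Delta>. partial_iso \<Delta> \<and> \<Gamma> \<subseteq> \<Delta>}"
  have "\<exists>M\<in>?A. \<forall>X\<in>?A. M \<subseteq> X \<longrightarrow> X = M"
  proof (rule subset_Zorn_nonempty)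
    show "?A \<noteq> {}" using assms by blast
    fix C assume C: "C \<noteq> {}" "subset.chain ?A C"
    hence iso: "\<And>\<Delta>. \<Delta> \<in> C \<Longrightarrow> partial_iso \<Delta>" and sub: "\<And>\<Delta>. \<Delta> \<in> C \<Longrightarrow> \<Gamma> \<subseteq> \<Delta>"
      unfolding subset.chain_def by auto
    have two: "\<exists>\<Delta>\<in>C. u \<in> \<Delta> \<and> v \<in> \<Delta>" if "u \<in> \<Union>C" "v \<in> \<Union>C" for u v
      using that C(2) unfolding subset_chain_def by blast
    have "partial_iso (\<Union>C)"
      unfolding partial_iso_def
    proof (intro conjI allI impI)
      show "(1, 1) \<in> \<Union>C" using C(1) iso partial_iso_1 by blast
      fix a b assume ab: "(a, b) \<in> \<Union>C"
      show "a = 0 \<longleftrightarrow> b = 0" using ab iso partial_iso_eq_0 by blast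
      fix c d assume "(c, d) \<in> \<Union>C"
      then obtain \<Delta> where "\<Delta> \<in> C" "(a, b) \<in> \<Delta>" "(c, d) \<in> \<Delta>" using two ab by blast
      thus "(a - c, b - d) \<in> \<Union>C" "(a * c, b * d) \<in> \<Union>C"
        using iso partial_iso_diff partial_iso_mult by blast+
    qed
    thus "\<Union>C \<in> ?A" using C(1) sub by blast
  qed
  then obtain M where M: "partial_iso M" "\<Gamma> \<subseteq> M" "\<forall>X\<in>?A. M \<subseteq> X \<longrightarrow> X = M" by blast
  hence "maximal_iso M" unfolding maximal_iso_def by blast
  thus thesis using that M(2) by blast
qed

text \<open>The fractions of \<open>\<Gamma>\<close> form a partial isomorphism containing
  \<open>\<Gamma>\<close>, so maximality makes the domain a field.\<close>

lemma maximal_iso_divide: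
  assumes "maximal_iso \<Gamma>" "(a, b) \<in> \<Gamma>" "(c, d) \<in> \<Gamma>" "c \<noteq> 0"
  shows "(a / c, b / d) \<in> \<Gamma>"
proof -
  have iso: "partial_iso \<Gamma>" using assms(1) unfolding maximal_iso_def by blast
  let ?D = "{(a / c, b / d) | a b c d. (a, b) \<in> \<Gamma> \<and> (c, d) \<in> \<Gamma> \<and> c \<noteq> 0}"
  have "\<Gamma> \<subseteq> ?D"
  proof (rule subrelI)
    fix a b assume "(a, b) \<in> \<Gamma>"
    thus "(a, b) \<in> ?D" using partial_iso_1[OF iso] by force
  qed
  moreover have "partial_iso ?D"
    unfolding partial_iso_def
  proof (intro conjI allI impI)
    show "(1, 1) \<in> ?D" using partial_iso_1[OF iso] \<open>\<Gamma> \<subseteq> ?D\<close> by blast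
    fix a b assume "(a, b) \<in> ?D"
    then obtain p q r s where 1: "a = p / r" "b = q / s" "(p, q) \<in> \<Gamma>" "(r, s) \<in> \<Gamma>" "r \<noteq> 0" by blast
    have s: "s \<noteq> 0" using 1 partial_iso_eq_0[OF iso] by blast
    show "a = 0 \<longleftrightarrow> b = 0" using 1 s partial_iso_eq_0[OF iso 1(3)] by simp
    fix c d assume "(c, d) \<in> ?D"
    then obtain p' q' r' s' where 2: "c = p' / r'" "d = q' / s'" "(p', q') \<in> \<Gamma>" "(r', s') \<in> \<Gamma>" "r' \<noteq> 0" by blast
    have s': "s' \<noteq> 0" using 2 partial_iso_eq_0[OF iso] by blast
    have "(p * r' - p' * r, q * s' - q' * s) \<in> \<Gamma>" "(r * r', s * s') \<in> \<Gamma>" "(p * p', q * q') \<in> \<Gamma>"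
      using 1 2 iso by (auto intro!: partial_iso_diff partial_iso_mult)
    moreover have "a - c = (p * r' - p' * r) / (r * r')" "b - d = (q * s' - q' * s) / (s * s')"
      using 1 2 s s' by (simp_all add: diff_frac_eq)
    moreover have "a * c = (p * p') / (r * r')" "b * d = (q * q') / (s * s')"
      using 1 2 by simp_all
    moreover have "r * r' \<noteq> 0" using 1 2 by simp
    ultimately show "(a - c, b - d) \<in> ?D" "(a * c, b * d) \<in> ?D" by blast+
  qed
  ultimately have "?D = \<Gamma>" using assms(1) unfolding maximal_iso_def by blast
  thus ?thesis using assms by blast
qed

text \<open>Division with remainder is run on both sides at once, so that quotients and remainders
  stay related. This works because quotients of leading coefficients stay in
  \<open>\<Gamma>\<close>.\<close>

lemma poly_rel_division:
  assumes max: "maximal_iso \<Gamma>" and mn: "poly_rel \<Gamma> m n" "m \<noteq> 0" and "poly_rel \<Gamma> p q"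
  shows "\<exists>s t r u. poly_rel \<Gamma> s t \<and> poly_rel \<Gamma> r u \<and> p = m * s + r \<and> q = n * t + u \<and>
           (r = 0 \<or> degree r < degree m)"
  using assms(4)
proof (induction "degree p" arbitrary: p q rule: less_induct)
  case less
  have iso: "partial_iso \<Gamma>" using max unfolding maximal_iso_def by blast
  have 0: "poly_rel \<Gamma> 0 0" using partial_iso_0[OF iso] unfolding poly_rel_def by simp
  show ?case
  proof (cases "p = 0 \<or> degree p < degree m")
    case True
    thus ?thesis using 0 less(2) by (intro exI[of _ 0] exI[of _ p] exI[of _ q]) auto
  next
    case False
    let ?d = "degree p - degree m"
    define a where "a = lead_coeff p / lead_coeff m"
    define b where "b = lead_coeff q / lead_coeff n"
    have deg: "degree n = degree m" "degree q = degree p"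
      using poly_rel_degree[OF iso] mn(1) less(2) by simp_all
    have ab: "(a, b) \<in> \<Gamma>"
      unfolding a_def b_def using mn less(2) deg
      by (intro maximal_iso_divide[OF max]) (simp_all add: poly_rel_def)
    let ?M = "monom a ?d" and ?N = "monom b ?d"
    have MN: "poly_rel \<Gamma> ?M ?N" using ab iso by (simp add: poly_rel_monom)
    have rel: "poly_rel \<Gamma> (p - m * ?M) (q - n * ?N)"
      by (intro poly_rel_diff[OF iso] less(2) poly_rel_mult[OF iso] mn MN)
    have a0: "a \<noteq> 0" unfolding a_def using False mn by simp
    have "p - m * ?M = 0 \<or> degree (p - m * ?M) < degree p"
    \<comment> \<open>For constants the degree cannot drop; there the difference vanishes.\<close>
    proof (cases "degree p = 0")
      case True
      hence "degree m = 0" using False by simp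
      then obtain c e where "p = [:c:]" "m = [:e:]" using True by (metis degree_eq_zeroE)
      hence "p - m * ?M = 0" unfolding a_def using mn by (simp add: monom_0)
      thus ?thesis by simp
    next
      case pos: False
      have "degree (m * ?M) = degree p"
        using False mn a0 by (simp add: degree_mult_eq degree_monom_eq)
      moreover have "coeff (m * ?M) (degree p) = coeff p (degree p)"
        using calculation lead_coeff_mult[of m ?M] mn a0 unfolding a_def
        by (simp add: degree_monom_eq)
      ultimately have "degree (p - m * ?M) \<le> degree p" "coeff (p - m * ?M) (degree p) = 0"
        by (auto intro: degree_diff_le)
      thus ?thesis using pos
        by (metis coeff_eq_0 le_neq_implies_less leading_coeff_0_iff)
    qed
    then obtain s t r u where *: "poly_rel \<Gamma> s t" "poly_rel \<Gamma> r u" "p - m * ?M = m * s + r"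
      "q - n * ?N = n * t + u" "r = 0 \<or> degree r < degree m"
    proof
      assume z: "p - m * ?M = 0"
      hence "q - n * ?N = 0" using poly_rel_eq_0[OF iso rel] by simp
      thus thesis using that[OF 0 0] z by simp
    next
      assume "degree (p - m * ?M) < degree p"
      from less(1)[OF this rel] show thesis using that by blast
    qed
    have "poly_rel \<Gamma> (?M + s) (?N + t)" using poly_rel_add[OF iso MN *(1)] .
    moreover have "p = m * (?M + s) + r" "q = n * (?N + t) + u"
      using *(3,4) by (simp_all add: algebra_simps)
    ultimately show ?thesis using *(2,5) by blast
  qed
qed

text \<open>Let \<open>m\<close> be a minimal polynomial of \<open>z\<close>, \<open>n\<close> its
  image and \<open>w\<close> a root of \<open>n\<close>; then \<open>(z, w)\<close> can be adjoined.
  In place of an irreducibility argument for \<open>n\<close>, a minimal polynomial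
  \<open>q'\<close> of \<open>w\<close> with preimage \<open>p'\<close> is compared with
  \<open>m\<close>.\<close>

lemma algebraic_in_Domain_maximal_iso:
  fixes \<Gamma> :: "('a::alg_closed_field \<times> 'a) set"
  assumes max: "maximal_iso \<Gamma>" and "algebraic_over (Domain \<Gamma>) z"
  shows "z \<in> Domain \<Gamma>"
proof -
  have iso: "partial_iso \<Gamma>" using max unfolding maximal_iso_def by blast
  obtain p where p: "p \<noteq> 0" "\<forall>i. coeff p i \<in> Domain \<Gamma>" "poly p z = 0"
    using assms(2) unfolding algebraic_over_def by blast
  have "\<forall>a\<in>Domain \<Gamma>. \<exists>b. (a, b) \<in> \<Gamma>" by blast
  then obtain f where f: "\<And>a. a \<in> Domain \<Gamma> \<Longrightarrow> (a, f a) \<in> \<Gamma>" by metis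
  have f0: "f 0 = 0" using f[of 0] partial_iso_0[OF iso] partial_iso_eq_0[OF iso] by blast
  have "poly_rel \<Gamma> p (map_poly f p)"
    unfolding poly_rel_def using p f by (simp add: coeff_map_poly f0)
  hence "(\<exists>n. poly_rel \<Gamma> p n) \<and> p \<noteq> 0 \<and> poly p z = 0" using p by blast
  from ex_has_least_nat[of "\<lambda>m. (\<exists>n. poly_rel \<Gamma> m n) \<and> m \<noteq> 0 \<and> poly m z = 0", OF this, of degree]
  obtain m n where mn: "poly_rel \<Gamma> m n" "m \<noteq> 0" "poly m z = 0"
    and min: "\<And>m' n'. poly_rel \<Gamma> m' n' \<Longrightarrow> m' \<noteq> 0 \<Longrightarrow> poly m' z = 0 \<Longrightarrow> degree m \<le> degree m'"
    by blast
  have "degree m \<noteq> 0" using mn(2,3) by (metis degree_eq_zeroE mult_zero_right add.right_neutral poly_pCons poly_0 pCons_0_0)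
  hence "degree n > 0" using poly_rel_degree[OF iso mn(1)] by simp
  then obtain w where w: "poly n w = 0" using alg_closed_imp_poly_has_root by blast
  have "n \<noteq> 0" using mn poly_rel_eq_0[OF iso] by blast
  hence "(\<exists>p. poly_rel \<Gamma> p n) \<and> n \<noteq> 0 \<and> poly n w = 0" using mn w by blast
  from ex_has_least_nat[of "\<lambda>q. (\<exists>p. poly_rel \<Gamma> p q) \<and> q \<noteq> 0 \<and> poly q w = 0", OF this, of degree]
  obtain p' q' where pq': "poly_rel \<Gamma> p' q'" "q' \<noteq> 0" "poly q' w = 0"
    and min': "\<And>m' n'. poly_rel \<Gamma> m' n' \<Longrightarrow> n' \<noteq> 0 \<Longrightarrow> poly n' w = 0 \<Longrightarrow> degree q' \<le> degree n'"
    by blast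
  have p'0: "p' \<noteq> 0" using pq' poly_rel_eq_0[OF iso] by blast
  have deg': "degree p' = degree q'" using pq' poly_rel_degree[OF iso] by blast
  have dvd: "\<exists>s t. poly_rel \<Gamma> s t \<and> p = m * s \<and> q = n * t" if pq: "poly_rel \<Gamma> p q" "poly p z = 0" for p q
  proof -
    obtain s t r u where *: "poly_rel \<Gamma> s t" "poly_rel \<Gamma> r u" "p = m * s + r" "q = n * t + u"
      "r = 0 \<or> degree r < degree m"
      using poly_rel_division[OF max mn(1,2) pq(1)] by blast
    have "poly r z = 0" using * pq mn by simp
    hence "r = 0" using min[OF *(2)] *(5) by force
    thus ?thesis using * poly_rel_eq_0[OF iso *(2)] by auto
  qed
  have dvd': "\<exists>s t. poly_rel \<Gamma> s t \<and> p = p' * s \<and> q = q' * t" if pq: "poly_rel \<Gamma> p q" "poly q w = 0" for p q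
  proof -
    obtain s t r u where *: "poly_rel \<Gamma> s t" "poly_rel \<Gamma> r u" "p = p' * s + r" "q = q' * t + u"
      "r = 0 \<or> degree r < degree p'"
      using poly_rel_division[OF max pq'(1) p'0 pq(1)] by blast
    have "poly u w = 0" using * pq pq' by simp
    hence "u = 0" using min'[OF *(2)] *(5) poly_rel_degree[OF iso *(2)] poly_rel_eq_0[OF iso *(2)] deg' by force
    thus ?thesis using * poly_rel_eq_0[OF iso *(2)] by auto
  qed
  have p'z: "poly p' z = 0"
  proof (rule ccontr)
    \<comment> \<open>Otherwise the cofactor \<open>s\<close> of \<open>p'\<close> in
      \<open>m\<close> vanishes at \<open>z\<close>. Minimality of \<open>m\<close> then makes
      \<open>p'\<close> and \<open>q'\<close> constant, but \<open>q'\<close> is nonzero with root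
      \<open>w\<close>.\<close>
    assume nz: "poly p' z \<noteq> 0"
    obtain s t where st: "poly_rel \<Gamma> s t" "m = p' * s" using dvd'[OF mn(1) w] by blast
    have "s \<noteq> 0" using st mn by auto
    hence "degree m \<le> degree s" using min[OF st(1)] st mn nz by simp
    moreover have "degree m = degree p' + degree s" using st p'0 \<open>s \<noteq> 0\<close> by (simp add: degree_mult_eq)
    ultimately have "degree q' = 0" using deg' by simp
    thus False using pq'(2,3) by (metis degree_eq_zeroE mult_zero_right add.right_neutral poly_pCons poly_0 pCons_0_0)
  qed
  have "partial_iso (adjoin_pair \<Gamma> z w)"
  proof (rule partial_iso_adjoin_pair[OF iso])
    fix p q assume pq: "poly_rel \<Gamma> p q"
    show "poly p z = 0 \<longleftrightarrow> poly q w = 0"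
      using dvd[OF pq] dvd'[OF pq] p'z w by auto
  qed
  hence "adjoin_pair \<Gamma> z w = \<Gamma>"
    using max subset_adjoin_pair[OF iso] unfolding maximal_iso_def by blast
  thus ?thesis using in_adjoin_pair[OF iso] by blast
qed

subsection \<open>Automorphisms and transcendental elements\<close>

definition adjoin :: "'a::field set \<Rightarrow> 'a \<Rightarrow> 'a set" where
  "adjoin K z = {poly p z | p. \<forall>i. coeff p i \<in> K}"

lemma subset_adjoin: "is_subring K \<Longrightarrow> K \<subseteq> adjoin K z"
proof
  fix a assume "is_subring K" "a \<in> K"
  hence "\<forall>i. coeff (monom a 0) i \<in> K" "a = poly (monom a 0) z"
    by (auto simp: is_subring_0 poly_monom)
  thus "a \<in> adjoin K z" unfolding adjoin_def by blast
qed

lemma in_adjoin: "is_subring K \<Longrightarrow> z \<in> adjoin K z"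
proof -
  assume K: "is_subring K"
  hence "\<forall>i. coeff (monom 1 1) i \<in> K" by (auto simp: is_subring_0 is_subring_def)
  moreover have "z = poly (monom 1 1) z" by (simp add: poly_monom)
  ultimately show ?thesis unfolding adjoin_def by blast
qed

lemma is_subring_adjoin:
  assumes "is_subring K"
  shows "is_subring (adjoin K z)"
  unfolding is_subring_def
proof (intro conjI ballI)
  show "1 \<in> adjoin K z" using assms subset_adjoin unfolding is_subring_def by blast
  fix a b assume "a \<in> adjoin K z" "b \<in> adjoin K z"
  then obtain p q where pq: "\<forall>i. coeff p i \<in> K" "a = poly p z" "\<forall>i. coeff q i \<in> K" "b = poly q z"
    unfolding adjoin_def by blast
  have "\<forall>i. coeff (p - q) i \<in> K" using pq assms unfolding is_subring_def by simp
  moreover have "a - b = poly (p - q) z" using pq by simp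
  ultimately show "a - b \<in> adjoin K z" unfolding adjoin_def by blast
  have "\<forall>i. coeff (p * q) i \<in> K" using pq assms is_subring_coeff_mult by blast
  moreover have "a * b = poly (p * q) z" using pq by simp
  ultimately show "a * b \<in> adjoin K z" unfolding adjoin_def by blast
qed

lemma adjoin_subset: "is_subring K \<Longrightarrow> L \<subseteq> K \<Longrightarrow> z \<in> K \<Longrightarrow> adjoin L z \<subseteq> K"
  unfolding adjoin_def using is_subring_poly by blast

lemma algebraic_over_mono: "K \<subseteq> L \<Longrightarrow> algebraic_over K z \<Longrightarrow> algebraic_over L z"
  unfolding algebraic_over_def by blast

lemma algebraic_over_self: "is_subring K \<Longrightarrow> z \<in> K \<Longrightarrow> algebraic_over K z"
proof -
  assume K: "is_subring K" "z \<in> K"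
  hence "\<forall>i. coeff [:- z, 1:] i \<in> K"
    by (auto simp: coeff_pCons is_subring_def is_subring_0 is_subring_minus split: nat.split)
  thus ?thesis unfolding algebraic_over_def by (intro exI[of _ "[:- z, 1:]"]) simp
qed

text \<open>
  An equation for \<open>x\<close> with coefficients in \<open>K[z]\<close> is a polynomial in \<open>x\<close> and \<open>z\<close>; it is read as an
  equation for \<open>z\<close>, which is nontrivial because \<open>x\<close> is transcendental over \<open>K\<close>.
\<close>

lemma algebraic_exchange:
  assumes K: "is_subring K" and x: "\<not> algebraic_over K x" and "algebraic_over (adjoin K z) x"
  shows "algebraic_over (adjoin K x) z"
proof -
  obtain p where p: "p \<noteq> 0" "\<And>i. coeff p i \<in> adjoin K z" "poly p x = 0"
    using assms(3) unfolding algebraic_over_def by blast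
  have "\<forall>i. \<exists>c. (\<forall>j. coeff c j \<in> K) \<and> coeff p i = poly c z"
    using p(2) unfolding adjoin_def by blast
  then obtain c where c: "\<And>i j. coeff (c i) j \<in> K" "\<And>i. coeff p i = poly (c i) z" by metis
  \<comment> \<open>\<open>q\<close> is the relation read in \<open>z\<close>; \<open>r j\<close> is
    its coefficient at the \<open>j\<close>-th power of \<open>z\<close>, as a polynomial in
    \<open>x\<close> over \<open>K\<close>.\<close>
  define q where "q = (\<Sum>i\<le>degree p. smult (x ^ i) (c i))"
  define r where "r j = (\<Sum>i\<le>degree p. monom (coeff (c i) j) i)" for j
  have rK: "coeff (r j) i \<in> K" for i j
    unfolding r_def coeff_sum using K c(1) by (intro is_subring_sum) (auto simp: is_subring_0)
  have qr: "coeff q j = poly (r j) x" for j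
    unfolding q_def r_def by (simp add: coeff_sum poly_sum poly_monom mult.commute)
  have "poly q z = 0"
    using p(3) unfolding q_def poly_altdef[of p] c(2) by (simp add: poly_sum mult.commute)
  moreover have "\<forall>j. coeff q j \<in> adjoin K x" unfolding qr adjoin_def using rK by blast
  moreover have "q \<noteq> 0"
  proof
    assume "q = 0"
    hence "poly (r j) x = 0" for j using qr by (metis coeff_0)
    hence "r j = 0" for j using x rK unfolding algebraic_over_def by blast
    \<comment> \<open>The leading coefficient of \<open>p\<close> is nonzero, so the relation is
      nontrivial already in the top power of \<open>x\<close>.\<close>
    moreover have "coeff (r j) (degree p) = coeff (c (degree p)) j" for j
      unfolding r_def coeff_sum by (simp add: sum.delta')
    ultimately have "c (degree p) = 0" by (simp add: poly_eq_iff)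
    thus False using c(2)[of "degree p"] p(1) by simp
  qed
  ultimately show ?thesis unfolding algebraic_over_def by blast
qed

text \<open>Zorn's lemma gives a maximal \<open>K\<close>. Adjoining some \<open>z\<close> outside
  \<open>K\<close> makes \<open>x\<close> or \<open>y\<close> algebraic, and the exchange property
  turns this into an equation for \<open>z\<close>.\<close>

lemma ex_maximal_transcendental_subring:
  assumes "is_subring K0" "\<not> algebraic_over K0 x" "\<not> algebraic_over K0 y"
  obtains K where "is_subring K" "\<not> algebraic_over K x" "\<not> algebraic_over K y"
    "\<And>z. algebraic_over (adjoin K x) z \<or> algebraic_over (adjoin K y) z"
proof -
  let ?A = "{K. is_subring K \<and> \<not> algebraic_over K x \<and> \<not> algebraic_over K y}"
  have "\<exists>M\<in>?A. \<forall>X\<in>?A. M \<subseteq> X \<longrightarrow> X = M"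
  proof (rule subset_Zorn_nonempty)
    show "?A \<noteq> {}" using assms by blast
    fix C assume C: "C \<noteq> {}" "subset.chain ?A C"
    hence CA: "\<And>K. K \<in> C \<Longrightarrow> K \<in> ?A" unfolding subset.chain_def by auto
    have two: "\<exists>K\<in>C. u \<in> K \<and> v \<in> K" if "u \<in> \<Union>C" "v \<in> \<Union>C" for u v
      using that C(2) unfolding subset_chain_def by blast
    have ring: "is_subring (\<Union>C)"
      unfolding is_subring_def
    proof (intro conjI ballI)
      show "1 \<in> \<Union>C" using C(1) CA unfolding is_subring_def by blast
      fix a b assume "a \<in> \<Union>C" "b \<in> \<Union>C"
      then obtain K where "K \<in> C" "a \<in> K" "b \<in> K" using two by blast
      thus "a - b \<in> \<Union>C" "a * b \<in> \<Union>C" using CA unfolding is_subring_def by blast+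
    qed
    have "\<not> algebraic_over (\<Union>C) u" if u: "\<And>K. K \<in> C \<Longrightarrow> \<not> algebraic_over K u" for u
    proof
      assume "algebraic_over (\<Union>C) u"
      then obtain p where p: "p \<noteq> 0" "\<forall>i. coeff p i \<in> \<Union>C" "poly p u = 0"
        unfolding algebraic_over_def by blast
      \<comment> \<open>The finitely many coefficients lie in one member of the chain.\<close>
      have "coeff p ` {..degree p} \<subseteq> \<Union>C" using p(2) by blast
      then obtain K where K: "K \<in> C" "coeff p ` {..degree p} \<subseteq> K"
        using finite_subset_Union_chain[OF _ _ C, of "coeff p ` {..degree p}"] by blast
      have "coeff p i \<in> K" for i
        using K is_subring_0 CA[OF K(1)] coeff_eq_0[of p i] by (cases "i \<le> degree p") auto
      thus False using p u[OF K(1)] unfolding algebraic_over_def by blast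
    qed
    thus "\<Union>C \<in> ?A" using ring CA by blast
  qed
  then obtain K where K: "is_subring K" "\<not> algebraic_over K x" "\<not> algebraic_over K y"
    and max: "\<forall>X\<in>?A. K \<subseteq> X \<longrightarrow> X = K" by blast
  have "algebraic_over (adjoin K x) z \<or> algebraic_over (adjoin K y) z" for z
  proof (cases "z \<in> K")
    case True
    thus ?thesis using algebraic_over_self is_subring_adjoin subset_adjoin K(1) by blast
  next
    case False
    hence "adjoin K z \<noteq> K" using in_adjoin[OF K(1), of z] by metis
    hence "adjoin K z \<notin> ?A" using max subset_adjoin[OF K(1)] by metis
    hence "algebraic_over (adjoin K z) x \<or> algebraic_over (adjoin K z) y"
      using is_subring_adjoin[OF K(1)] by blast
    thus ?thesis using algebraic_exchange[OF K(1)] K(2,3) by blast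
  qed
  thus thesis using that K by blast
qed

text \<open>Substitute \<open>a + X\<close> for the variable.\<close>

lemma algebraic_over_diff:
  assumes K: "is_subring K" and a: "a \<in> K" and "algebraic_over K (a + z)"
  shows "algebraic_over K z"
proof -
  obtain p where p: "p \<noteq> 0" "\<forall>i. coeff p i \<in> K" "poly p (a + z) = 0"
    using assms(3) unfolding algebraic_over_def by blast
  have "coeff [:a, 1:] i \<in> K" for i
    using K a by (auto simp: coeff_pCons is_subring_def is_subring_0 split: nat.split)
  hence "\<forall>i. coeff (pcompose p [:a, 1:]) i \<in> K" using is_subring_coeff_pcompose[OF K] p(2) by blast
  moreover have "pcompose p [:a, 1:] \<noteq> 0" using p(1) by (simp add: pcompose_eq_0_iff)
  moreover have "poly (pcompose p [:a, 1:]) z = 0" using p(3) by (simp add: poly_pcompose)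
  ultimately show ?thesis unfolding algebraic_over_def by blast
qed

theorem ex_automorphism_transcendental:
  fixes x y :: "'a::alg_closed_field"
  assumes "is_subring K0" "\<not> algebraic_over K0 x" "\<not> algebraic_over K0 y"
  obtains \<sigma> where "field_automorphism \<sigma>" "\<sigma> x = y"
proof -
  obtain K where K: "is_subring K" and xK: "\<not> algebraic_over K x" and yK: "\<not> algebraic_over K y"
    and alg: "\<And>z. algebraic_over (adjoin K x) z \<or> algebraic_over (adjoin K y) z"
    using ex_maximal_transcendental_subring[OF assms] by blast
  note [simp] = is_subring_adjoin[OF K] in_adjoin[OF K] subset_adjoin[OF K]
  \<comment> \<open>Applied to \<open>x + y\<close>, maximality gives one of the two dependences;
    exchange gives the other.\<close>
  have dep: "algebraic_over (adjoin K x) y \<and> algebraic_over (adjoin K y) x"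
    using alg[of "x + y"]
  proof
    assume "algebraic_over (adjoin K x) (x + y)"
    hence "algebraic_over (adjoin K x) y" using algebraic_over_diff[of "adjoin K x" x y] by simp
    thus ?thesis using algebraic_exchange[OF K yK] by blast
  next
    assume "algebraic_over (adjoin K y) (x + y)"
    hence "algebraic_over (adjoin K y) x"
      using algebraic_over_diff[of "adjoin K y" y x] by (simp add: add.commute)
    thus ?thesis using algebraic_exchange[OF K xK] by blast
  qed
  have iso0: "partial_iso (Id_on K)"
    using K unfolding partial_iso_def is_subring_def by auto
  \<comment> \<open>This is the graph of the isomorphism from \<open>K[x]\<close> to
    \<open>K[y]\<close>: both are polynomial rings because \<open>x\<close> and \<open>y\<close> are
    transcendental.\<close>
  have "partial_iso (adjoin_pair (Id_on K) x y)"
  proof (rule partial_iso_adjoin_pair[OF iso0])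
    fix p q assume "poly_rel (Id_on K) p q"
    hence *: "coeff p i \<in> K" "coeff p i = coeff q i" for i
      by (metis Id_on_iff poly_rel_def)+
    hence "p = q" by (simp add: poly_eq_iff)
    thus "poly p x = 0 \<longleftrightarrow> poly q y = 0"
      using * xK yK unfolding algebraic_over_def by (metis poly_0)
  qed
  then obtain \<Gamma> where \<Gamma>: "adjoin_pair (Id_on K) x y \<subseteq> \<Gamma>" and max: "maximal_iso \<Gamma>"
    using ex_maximal_iso by blast
  have iso: "partial_iso \<Gamma>" using max unfolding maximal_iso_def by blast
  have xy: "(x, y) \<in> \<Gamma>" and idK: "Id_on K \<subseteq> \<Gamma>"
    using \<Gamma> in_adjoin_pair[OF iso0] subset_adjoin_pair[OF iso0] by blast+
  \<comment> \<open>Stated for \<open>x\<close> and \<open>y\<close> in either order, so that it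
    also applies to the converse graph and gives surjectivity.\<close>
  have full: "Domain \<Delta> = UNIV"
    if D: "maximal_iso \<Delta>" "Id_on K \<subseteq> \<Delta>" "u \<in> Domain \<Delta>" "algebraic_over (adjoin K u) v"
      "{u, v} = {x, y}" for \<Delta> u v
  proof -
    have ring: "is_subring (Domain \<Delta>)" using D(1) subring_Domain unfolding maximal_iso_def by blast
    have KD: "K \<subseteq> Domain \<Delta>" using D(2) by blast
    have "v \<in> Domain \<Delta>"
      using algebraic_in_Domain_maximal_iso[OF D(1)] adjoin_subset[OF ring KD D(3)]
        algebraic_over_mono D(4) by blast
    hence "x \<in> Domain \<Delta>" "y \<in> Domain \<Delta>" using D(3,5) by (auto simp: doubleton_eq_iff)
    hence "adjoin K x \<subseteq> Domain \<Delta>" "adjoin K y \<subseteq> Domain \<Delta>"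
      using adjoin_subset[OF ring KD] by simp_all
    hence "algebraic_over (Domain \<Delta>) w" for w
      using alg[of w] algebraic_over_mono by metis
    thus ?thesis using algebraic_in_Domain_maximal_iso[OF D(1)] by blast
  qed
  have dom: "Domain \<Gamma> = UNIV" using full[OF max idK, of x y] xy dep by blast
  have "Domain (\<Gamma>\<inverse>) = UNIV"
    by (rule full[OF maximal_iso_converse[OF max], of y x]) (use idK xy dep in auto)
  hence ran: "Range \<Gamma> = UNIV" by simp
  have "\<forall>a. \<exists>b. (a, b) \<in> \<Gamma>" using dom by blast
  then obtain \<sigma> where \<sigma>: "\<And>a. (a, \<sigma> a) \<in> \<Gamma>" by metis
  have \<sigma>I: "\<sigma> a = b" if "(a, b) \<in> \<Gamma>" for a b using partial_iso_unique[OF iso \<sigma> that] .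
  have "inj \<sigma>"
    using partial_iso_unique[of "\<Gamma>\<inverse>"] iso \<sigma> by (metis converseI injI partial_iso_converse)
  moreover have "surj \<sigma>"
    unfolding surj_def
  proof
    fix b
    have "b \<in> Range \<Gamma>" using ran by simp
    then obtain a where "(a, b) \<in> \<Gamma>" by blast
    hence "b = \<sigma> a" using \<sigma>I by simp
    thus "\<exists>a. b = \<sigma> a" by blast
  qed
  moreover have "\<sigma> 1 = 1" "\<sigma> (a + b) = \<sigma> a + \<sigma> b" "\<sigma> (a * b) = \<sigma> a * \<sigma> b" for a b
    by (rule \<sigma>I partial_iso_1[OF iso] partial_iso_add[OF iso] partial_iso_mult[OF iso] \<sigma>)+
  ultimately have "field_automorphism \<sigma>"
    unfolding field_automorphism_def bij_def by blast
  thus thesis using that \<sigma>I[OF xy] by blast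
qed

section \<open>Field automorphisms and the prime field\<close>

lemma field_automorphism_0: "field_automorphism \<sigma> \<Longrightarrow> \<sigma> 0 = 0"
  unfolding field_automorphism_def by (metis add_cancel_right_right)

lemma field_automorphism_minus: "field_automorphism \<sigma> \<Longrightarrow> \<sigma> (- a) = - \<sigma> a"
  using field_automorphism_0 unfolding field_automorphism_def
  by (metis add.right_inverse add_eq_0_iff)

lemma field_automorphism_inverse: "field_automorphism \<sigma> \<Longrightarrow> \<sigma> (inverse a) = inverse (\<sigma> a)"
  using field_automorphism_0 unfolding field_automorphism_def
  by (metis inverse_unique inverse_zero right_inverse)

lemma field_automorphism_sum:
  "field_automorphism \<sigma> \<Longrightarrow> \<sigma> (sum f I) = (\<Sum>i\<in>I. \<sigma> (f i))"
  by (induction I rule: infinite_finite_induct)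
     (auto simp: field_automorphism_0, simp add: field_automorphism_def)

lemma field_automorphism_power: "field_automorphism \<sigma> \<Longrightarrow> \<sigma> (a ^ n) = \<sigma> a ^ n"
  by (induction n) (auto simp: field_automorphism_def)

text \<open>The fixed points of \<open>\<sigma>\<close> form a subfield.\<close>

lemma field_automorphism_prime_field:
  assumes "field_automorphism \<sigma>" "a \<in> prime_field"
  shows "\<sigma> a = a"
proof -
  have "is_subfield {a. \<sigma> a = a}"
    using assms(1) unfolding is_subfield_def
    by (auto simp: field_automorphism_0 field_automorphism_minus field_automorphism_inverse)
       (auto simp: field_automorphism_def)
  thus ?thesis using assms(2) unfolding prime_field_def by blast
qed

lemma is_subring_prime_field: "is_subring (prime_field :: 'a::field set)"
  unfolding is_subring_def
proof (intro conjI ballI)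
  show "1 \<in> (prime_field :: 'a set)" unfolding prime_field_def is_subfield_def by blast
  fix a b :: 'a assume ab: "a \<in> prime_field" "b \<in> prime_field"
  show "a - b \<in> prime_field"
    unfolding prime_field_def
  proof safe
    fix K :: "'a set" assume K: "is_subfield K"
    hence "a \<in> K" "b \<in> K" using ab unfolding prime_field_def by blast+
    thus "a - b \<in> K" using K unfolding is_subfield_def by (metis add_uminus_conv_diff)
  qed
  show "a * b \<in> prime_field"
    using ab unfolding prime_field_def is_subfield_def by blast
qed

text \<open>
  These are the elements that are algebraic over the prime field. Describing them by their orbits
  under the automorphism group makes it immediate that they form a subfield.
\<close>

definition orbit_finite_elems :: "'a::field set" where
  "orbit_finite_elems = {z. finite {\<sigma> z | \<sigma>. field_automorphism \<sigma>}}"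

text \<open>The orbit of a sum or product lies in an image of the product of the two orbits;
  negatives and inverses are similar.\<close>

lemma is_subfield_orbit_finite_elems: "is_subfield (orbit_finite_elems :: 'a::field set)"
proof -
  define orb :: "'a \<Rightarrow> 'a set" where "orb z = {\<sigma> z | \<sigma>. field_automorphism \<sigma>}" for z
  have orbI: "\<sigma> a \<in> orb a" if "field_automorphism \<sigma>" for \<sigma> a
    using that unfolding orb_def by blast
  have "orb 0 \<subseteq> {0}" "orb 1 \<subseteq> {1}"
    unfolding orb_def by (auto simp: field_automorphism_0) (simp add: field_automorphism_def)
  moreover have "orb (- a) \<subseteq> uminus ` orb a" "orb (inverse a) \<subseteq> inverse ` orb a" for a
    unfolding orb_def using field_automorphism_minus field_automorphism_inverse by fast+
  moreover have "orb (a + b) \<subseteq> (\<lambda>(u, v). u + v) ` (orb a \<times> orb b)"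
    "orb (a * b) \<subseteq> (\<lambda>(u, v). u * v) ` (orb a \<times> orb b)" for a b
  proof safe
    fix z
    {
      assume "z \<in> orb (a + b)"
      then obtain \<sigma> where "field_automorphism \<sigma>" "z = \<sigma> a + \<sigma> b"
        unfolding orb_def field_automorphism_def by blast
      thus "z \<in> (\<lambda>(u, v). u + v) ` (orb a \<times> orb b)"
        using orbI by (intro image_eqI[of _ _ "(\<sigma> a, \<sigma> b)"]) simp_all
    next
      assume "z \<in> orb (a * b)"
      then obtain \<sigma> where "field_automorphism \<sigma>" "z = \<sigma> a * \<sigma> b"
        unfolding orb_def field_automorphism_def by blast
      thus "z \<in> (\<lambda>(u, v). u * v) ` (orb a \<times> orb b)"
        using orbI by (intro image_eqI[of _ _ "(\<sigma> a, \<sigma> b)"]) simp_all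
    }
  qed
  ultimately have "finite (orb 0)" "finite (orb 1)"
    "finite (orb a) \<Longrightarrow> finite (orb (- a))" "finite (orb a) \<Longrightarrow> finite (orb (inverse a))"
    "finite (orb a) \<Longrightarrow> finite (orb b) \<Longrightarrow> finite (orb (a + b))"
    "finite (orb a) \<Longrightarrow> finite (orb b) \<Longrightarrow> finite (orb (a * b))" for a b
    by (meson finite.emptyI finite.insertI finite_SigmaI finite_imageI finite_subset)+
  hence "is_subfield {z. finite (orb z)}"
    unfolding is_subfield_def by simp
  thus ?thesis unfolding orbit_finite_elems_def orb_def .
qed

text \<open>Automorphisms fix the coefficients, so they send \<open>z\<close> to roots of the same
  polynomial.\<close>

lemma algebraic_orbit_finite:
  assumes "algebraic_over prime_field z"
  shows "z \<in> orbit_finite_elems"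
proof -
  obtain p where p: "p \<noteq> 0" "\<forall>i. coeff p i \<in> prime_field" "poly p z = 0"
    using assms unfolding algebraic_over_def by blast
  have "poly p (\<sigma> z) = 0" if "field_automorphism \<sigma>" for \<sigma>
  proof -
    have mult: "\<And>a b. \<sigma> (a * b) = \<sigma> a * \<sigma> b" using that unfolding field_automorphism_def by blast
    have "poly p (\<sigma> z) = \<sigma> (poly p z)"
      unfolding poly_altdef using p(2) field_automorphism_prime_field[OF that]
      by (simp add: field_automorphism_sum[OF that] mult field_automorphism_power[OF that])
    thus ?thesis using p(3) field_automorphism_0[OF that] by simp
  qed
  hence "{\<sigma> z | \<sigma>. field_automorphism \<sigma>} \<subseteq> {w. poly p w = 0}" by blast
  thus ?thesis unfolding orbit_finite_elems_def
    using poly_roots_finite[OF p(1)] finite_subset by blast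
qed

text \<open>Substitute \<open>X ^ n\<close> for the variable; \<open>n > 0\<close> keeps the
  polynomial nonzero.\<close>

lemma algebraic_over_power:
  assumes K: "is_subring K" and "algebraic_over K (x ^ n)" "n > 0"
  shows "algebraic_over K x"
proof -
  obtain p where p: "p \<noteq> 0" "\<forall>i. coeff p i \<in> K" "poly p (x ^ n) = 0"
    using assms unfolding algebraic_over_def by blast
  have "poly (pcompose p (monom 1 n)) x = 0" using p(3) by (simp add: poly_pcompose poly_monom)
  moreover have "pcompose p (monom 1 n) \<noteq> 0"
    using p(1) assms(3) by (simp add: pcompose_eq_0_iff degree_monom_eq)
  moreover have "coeff (monom 1 n) i \<in> K" for i using K by (simp add: is_subring_def is_subring_0)
  hence "\<forall>i. coeff (pcompose p (monom 1 n)) i \<in> K" using is_subring_coeff_pcompose[OF K] p(2) by blast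
  ultimately show ?thesis unfolding algebraic_over_def by blast
qed

text \<open>All powers of \<open>x\<close> with positive exponent are transcendental, hence in the
  orbit of \<open>x\<close>. If the orbit is finite, two of them coincide, which is an equation for
  \<open>x\<close>.\<close>

lemma transcendental_not_orbit_finite:
  fixes x :: "'a::alg_closed_field"
  assumes x: "\<not> algebraic_over prime_field x"
  shows "x \<notin> orbit_finite_elems"
proof
  assume "x \<in> orbit_finite_elems"
  have "range (\<lambda>n. x ^ Suc n) \<subseteq> {\<sigma> x | \<sigma>. field_automorphism \<sigma>}"
  proof safe
    fix n
    have "\<not> algebraic_over prime_field (x ^ Suc n)"
      using x algebraic_over_power[OF is_subring_prime_field] by blast
    from ex_automorphism_transcendental[OF is_subring_prime_field x this]
    show "\<exists>\<sigma>. x ^ Suc n = \<sigma> x \<and> field_automorphism \<sigma>" by metis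
  qed
  hence "finite (range (\<lambda>n. x ^ Suc n))"
    using \<open>x \<in> orbit_finite_elems\<close> finite_subset unfolding orbit_finite_elems_def by blast
  hence "\<not> inj (\<lambda>n. x ^ Suc n)" using finite_imageD by blast
  then obtain m n where mn: "m \<noteq> n" "x ^ Suc m = x ^ Suc n" unfolding inj_def by blast
  define p :: "'a poly" where "p = monom 1 (Suc m) - monom 1 (Suc n)"
  have "coeff p (Suc m) = 1" using mn(1) by (simp add: p_def)
  hence "p \<noteq> 0" by auto
  moreover have "\<forall>i. coeff p i \<in> prime_field"
    using is_subring_prime_field is_subring_0[OF is_subring_prime_field]
    by (auto simp: p_def is_subring_def)
  moreover have "poly p x = 0" using mn(2) by (simp add: p_def poly_monom)
  ultimately show False using x unfolding algebraic_over_def by blast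
qed

text \<open>An equation for \<open>x\<close> is a relation in the single variable indexed by
  \<open>x\<close>.\<close>

lemma algebraically_independent_transcendental:
  assumes ind: "algebraically_independent K S" and x: "x \<in> S" and K: "0 \<in> K"
  shows "\<not> algebraic_over K x"
proof
  assume "algebraic_over K x"
  then obtain p where p: "p \<noteq> 0" "\<forall>i. coeff p i \<in> K" "poly p x = 0"
    unfolding algebraic_over_def by blast
  let ?m = "\<lambda>i. Poly_Mapping.single x (i::nat)"
  have inj: "inj ?m" by (simp add: inj_def) (metis lookup_single_eq)
  define P :: "'a mpolynomial" where
    "P = (\<Sum>i\<le>degree p. Poly_Mapping.single (?m i) (coeff p i))"
  have lookup_m: "Poly_Mapping.lookup P (?m i) = coeff p i" for i
    using inj by (cases "i \<le> degree p")
      (auto simp: P_def lookup_sum lookup_single when_def inj_eq coeff_eq_0)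
  have lookup_other: "Poly_Mapping.lookup P m = 0" if "m \<notin> range ?m" for m
    using that by (auto simp: P_def lookup_sum lookup_single when_def intro!: sum.neutral)
  have keys: "Poly_Mapping.keys P \<subseteq> ?m ` {..degree p}"
  proof
    fix m assume "m \<in> Poly_Mapping.keys P"
    hence nz: "Poly_Mapping.lookup P m \<noteq> 0" by (simp add: in_keys_iff)
    then obtain i where i: "m = ?m i" using lookup_other by blast
    hence "i \<le> degree p" using nz lookup_m by (metis le_degree)
    thus "m \<in> ?m ` {..degree p}" using i by blast
  qed
  have "mpoly_over K S P"
    unfolding mpoly_over_def
  proof (intro conjI allI ballI)
    show "Poly_Mapping.lookup P m \<in> K" for m
      using lookup_m lookup_other p(2) K by (cases "m \<in> range ?m") auto
    fix m assume "m \<in> Poly_Mapping.keys P"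
    thus "Poly_Mapping.keys m \<subseteq> S" using keys x by (auto split: if_splits)
  qed
  moreover have "mpoly_eval P = 0"
  proof -
    have monomial: "(\<Prod>y\<in>Poly_Mapping.keys (?m i). y ^ Poly_Mapping.lookup (?m i) y) = x ^ i" for i
      by simp
    have "mpoly_eval P = (\<Sum>m\<in>?m ` {..degree p}. Poly_Mapping.lookup P m *
        (\<Prod>y\<in>Poly_Mapping.keys m. y ^ Poly_Mapping.lookup m y))"
      unfolding mpoly_eval_def using keys by (intro sum.mono_neutral_left) (auto simp: in_keys_iff)
    also have "\<dots> = (\<Sum>i\<le>degree p. coeff p i * x ^ i)"
      unfolding sum.reindex[OF inj_on_subset[OF inj subset_UNIV]] comp_def lookup_m monomial ..
    finally show ?thesis using p(3) by (simp add: poly_altdef)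
  qed
  ultimately have "P = 0" using ind unfolding algebraically_independent_def by blast
  hence "coeff p i = 0" for i using lookup_m[of i] by simp
  thus False using p(1) by (simp add: poly_eq_iff)
qed

text \<open>If the empty set were the only finite independent set, the supremum would be 0.\<close>

lemma ex_transcendental:
  assumes "1 \<le> transcendence_degree K" "0 \<in> K"
  obtains x where "\<not> algebraic_over K x"
proof -
  have "\<exists>S. finite S \<and> algebraically_independent K S \<and> S \<noteq> {}"
  proof (rule ccontr)
    assume "\<not> ?thesis"
    hence "transcendence_degree K \<le> 0"
      unfolding transcendence_degree_def by (intro Sup_least) (auto simp: zero_enat_def)
    thus False using assms(1) by (metis ile0_eq not_one_le_zero)
  qed
  thus thesis using that algebraically_independent_transcendental[OF _ _ assms(2)] by blast
qed

subsection \<open>Additive and line-preserving maps\<close>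

lemma hua_identity:
  fixes a b :: "'a::field"
  assumes "a \<noteq> 0" "b \<noteq> 0" "a * b \<noteq> 1"
  shows "a - inverse (inverse a + inverse (inverse b - a)) = a * a * b"
proof -
  have c: "inverse b - a \<noteq> 0" using assms by (metis right_inverse eq_iff_diff_eq_0 mult.commute)
  have "inverse a + inverse (inverse b - a) = inverse b / (a * (inverse b - a))"
    using assms(1) c by (simp add: field_simps)
  hence "inverse (inverse a + inverse (inverse b - a)) = a * (inverse b - a) * b"
    by (simp add: inverse_eq_divide)
  thus ?thesis using assms(2) by (simp add: algebra_simps)
qed

text \<open>\<open>g\<close> is \<open>h\<close> conjugated by inversion, so \<open>h\<close> passes
  through the nested inverses of Hua's identity by alternating with \<open>g\<close>.\<close>

lemma additive_inverse_field_automorphism: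
  fixes h g :: "'a::alg_closed_field \<Rightarrow> 'a"
  assumes bij: "bij h" and h1: "h 1 = 1"
    and h_add: "\<And>a b. h (a + b) = h a + h b"
    and g: "\<And>a. g a = inverse (h (inverse a))"
    and g_add: "\<And>a b. g (a + b) = g a + g b"
  shows "field_automorphism h"
proof -
  have h0: "h 0 = 0" using h_add[of 0 0] by (metis add_0 add_cancel_left_left)
  have hz: "h a = 0 \<longleftrightarrow> a = 0" for a using bij h0 by (metis bij_pointE)
  have h_diff: "h (a - b) = h a - h b" for a b using h_add[of "a - b" b] by simp
  have h_inv: "h (inverse a) = inverse (g a)" for a using g[of a] by simp
  \<comment> \<open>Hua's identity is used twice: for \<open>a\<close> and \<open>b\<close> to
    decompose the argument, and for \<open>h a\<close> and \<open>g b\<close> to recombine the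
    values.\<close>
  have key: "h (a * a * b) = h a * h a * g b" if ab: "a \<noteq> 0" "b \<noteq> 0" "a * b \<noteq> 1" for a b
  proof -
    have "inverse b - a \<noteq> 0" using ab by (metis right_inverse eq_iff_diff_eq_0 mult.commute)
    hence "h (inverse b - a) \<noteq> 0" using hz by simp
    hence nz: "inverse (g b) - h a \<noteq> 0" by (simp add: h_diff h_inv)
    have gb: "g b \<noteq> 0" using ab g hz by simp
    have "h a * g b \<noteq> 1" using nz gb by (metis eq_iff_diff_eq_0 inverse_unique mult.commute)
    from hua_identity[OF _ gb this] have *: "h a - inverse (inverse (h a) + inverse (inverse (g b) - h a)) = h a * h a * g b"
      using ab hz by simp
    have "h (a * a * b) = h a - inverse (g (inverse a + inverse (inverse b - a)))"
      unfolding hua_identity[OF ab, symmetric] by (simp only: h_diff h_inv)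
    also have "g (inverse a + inverse (inverse b - a)) = inverse (h a) + inverse (inverse (g b) - h a)"
      by (simp only: g_add) (simp add: g h_diff)
    finally show ?thesis using * by simp
  qed
  \<comment> \<open>Setting \<open>a = 1\<close> in \<open>key\<close> identifies \<open>g\<close>
    with \<open>h\<close>; next, \<open>b = 1\<close> handles squares. The values excluded by
    \<open>key\<close> are checked directly.\<close>
  have gh: "g b = h b" for b
  proof (cases "b = 0 \<or> b = 1")
    case True thus ?thesis using g h0 h1 by auto
  next
    case False thus ?thesis using key[of 1 b] h1 by simp
  qed
  have sq: "h (a * a) = h a * h a" for a
  proof (cases "a = 0 \<or> a = 1")
    case True thus ?thesis using h0 h1 by auto
  next
    case False thus ?thesis using key[of a 1] h1 gh by simp
  qed
  have "h (a * a * b) = h (a * a) * h b" for a b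
  proof (cases "a = 0 \<or> b = 0 \<or> a * b = 1")
    case False thus ?thesis using key[of a b] gh sq by simp
  next
    case True
    moreover have "h (a * a * b) = h (a * a) * h b" if ab: "a * b = 1"
    proof -
      have b: "b = inverse a" using ab by (metis inverse_unique)
      have "a \<noteq> 0" using ab by auto
      thus ?thesis using hz[of a] by (simp add: b h_inv gh sq mult.assoc)
    qed
    ultimately show ?thesis using h0 by auto
  qed
  \<comment> \<open>Every element is a square, so the factor \<open>a * a\<close> is
    arbitrary.\<close>
  hence "h (a * b) = h a * h b" for a b
    using nth_root_exists[of 2 a] by (metis power2_eq_square zero_less_numeral)
  thus ?thesis unfolding field_automorphism_def using bij h1 h_add by blast
qed

text \<open>The affine line through \<open>a\<close> and \<open>b\<close> in the field viewed as a
  vector space over \<open>K\<close>; it is a point if \<open>a = b\<close>.\<close>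

definition line :: "'a::field set \<Rightarrow> 'a \<Rightarrow> 'a \<Rightarrow> 'a set" where
  "line K a b = {a + (b - a) * s | s. s \<in> K}"

lemma is_subfield_diff: "is_subfield K \<Longrightarrow> a \<in> K \<Longrightarrow> b \<in> K \<Longrightarrow> a - b \<in> K"
  unfolding is_subfield_def by (metis add_uminus_conv_diff)

lemma is_subfield_divide: "is_subfield K \<Longrightarrow> a \<in> K \<Longrightarrow> b \<in> K \<Longrightarrow> a / b \<in> K"
  unfolding is_subfield_def by (metis divide_inverse)

lemma is_subfield_mult: "is_subfield K \<Longrightarrow> a \<in> K \<Longrightarrow> b \<in> K \<Longrightarrow> a * b \<in> K"
  and is_subfield_add: "is_subfield K \<Longrightarrow> a \<in> K \<Longrightarrow> b \<in> K \<Longrightarrow> a + b \<in> K"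
  and is_subfield_0: "is_subfield K \<Longrightarrow> 0 \<in> K"
  and is_subfield_1: "is_subfield K \<Longrightarrow> 1 \<in> K"
  unfolding is_subfield_def by blast+

lemmas is_subfield_intros =
  is_subfield_diff is_subfield_divide is_subfield_mult is_subfield_add is_subfield_0 is_subfield_1

text \<open>
  If \<open>u, v\<close> are independent over \<open>K\<close>, then \<open>u + v\<close> lies on the line through \<open>u / (1 - t)\<close> and
  \<open>v / t\<close>, so \<open>f (u + v)\<close> is a combination of \<open>f u\<close> and \<open>f v\<close>. Its coefficients are 1 because the
  line through \<open>u\<close> and \<open>u + v\<close> is disjoint from the line through \<open>0\<close> and \<open>v\<close>. For dependent
  \<open>u, v\<close> add a vector \<open>w\<close> independent of both.
\<close>

lemma line_preserving_additive:
  fixes f :: "'a::field \<Rightarrow> 'a"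
  assumes K: "is_subfield K" and t: "t \<in> K" "t \<noteq> 0" "t \<noteq> 1" and proper: "K \<noteq> UNIV"
    and inj: "inj f" and f0: "f 0 = 0"
    and line: "\<And>a b. f ` line K a b = line K (f a) (f b)"
  shows "f (u + v) = f u + f v"
proof -
  \<comment> \<open>Linear independence over \<open>K\<close>; the scalar \<open>s = 0\<close> also
    excludes \<open>v = 0\<close>.\<close>
  define indep where "indep u v \<longleftrightarrow> u \<noteq> 0 \<and> (\<forall>s\<in>K. v \<noteq> s * u)" for u v :: 'a
  have line_0: "line K 0 a = {s * a | s. s \<in> K}" for a
    unfolding line_def by (simp add: mult.commute)
  have sym: "indep v u" if "indep u v" for u v
    unfolding indep_def
  proof (intro conjI ballI notI)
    assume "v = 0" thus False using that is_subfield_0[OF K] unfolding indep_def by force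
  next
    fix s assume s: "s \<in> K" "u = s * v"
    hence "v = (1 / s) * u" using that unfolding indep_def by auto
    thus False using that s K unfolding indep_def by (metis is_subfield_1 is_subfield_divide)
  qed
  have f_line_0: "f a \<in> line K 0 (f b) \<longleftrightarrow> a \<in> line K 0 b" for a b
    using line[of 0 b] f0 inj by (metis inj_image_mem_iff)
  have indep_f: "indep (f u) (f v)" if "indep u v" for u v
    unfolding indep_def
  proof (intro conjI ballI notI)
    assume "f u = 0" thus False using that inj f0 unfolding indep_def by (metis injD)
  next
    fix s assume "s \<in> K" "f v = s * f u"
    hence "f v \<in> line K 0 (f u)" unfolding line_0 by blast
    hence "v \<in> line K 0 u" using f_line_0 by blast
    thus False using that unfolding line_0 indep_def by blast
  qed
  have half: "\<exists>r\<in>K. f (u + v) = f u + r * f v" if uv: "indep u v" for u v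
  proof -
    define p q where "p = (1 / (1 - t)) * u" and "q = (1 / t) * v"
    have "p + (q - p) * t = (1 - t) * p + t * q" by (simp add: algebra_simps)
    also have "\<dots> = u + v" using t unfolding p_def q_def by simp
    finally have "u + v \<in> line K p q" unfolding line_def using t(1) by force
    hence "f (u + v) \<in> line K (f p) (f q)" using line by blast
    then obtain s3 where s3: "s3 \<in> K" "f (u + v) = f p + (f q - f p) * s3"
      unfolding line_def by blast
    have "p \<in> line K 0 u" "q \<in> line K 0 v"
      unfolding p_def q_def line_0 using K t by (blast intro: is_subfield_intros)+
    hence "f p \<in> line K 0 (f u)" "f q \<in> line K 0 (f v)" using f_line_0 by blast+
    then obtain s1 s2 where s12: "s1 \<in> K" "s2 \<in> K" "f p = s1 * f u" "f q = s2 * f v"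
      unfolding line_0 by blast
    define s r where "s = s1 * (1 - s3)" and "r = s2 * s3"
    have sr: "s \<in> K" "r \<in> K" unfolding s_def r_def using K s12 s3 by (auto intro: is_subfield_intros)
    have eq: "f (u + v) = s * f u + r * f v"
      unfolding s3 s12 s_def r_def by (simp add: algebra_simps)
    \<comment> \<open>Otherwise the line through \<open>f u\<close> and \<open>f (u + v)\<close>
      meets the line through 0 and \<open>f v\<close>, at the parameter
      \<open>l = 1 / (1 - s)\<close> of the former.\<close>
    have "s = 1"
    proof (rule ccontr)
      assume "s \<noteq> 1"
      define l where "l = 1 / (1 - s)"
      have l: "l \<in> K" "l * (1 - s) = 1" unfolding l_def using K sr \<open>s \<noteq> 1\<close> by (auto intro: is_subfield_intros)
      have "f u + (f (u + v) - f u) * l = (1 - l * (1 - s)) * f u + (r * l) * f v"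
        unfolding eq by (simp add: algebra_simps)
      hence pt: "f u + (f (u + v) - f u) * l = (r * l) * f v" using l by simp
      have "(r * l) * f v \<in> line K 0 (f v)" unfolding line_0 using K sr l by (blast intro: is_subfield_mult)
      hence "(r * l) * f v \<in> f ` line K 0 v" using line[of 0 v] f0 by simp
      moreover have "(r * l) * f v \<in> f ` line K u (u + v)"
        unfolding line pt[symmetric] using l unfolding line_def by blast
      ultimately obtain c d where "c \<in> K" "d \<in> K" "c * v = u + v * d"
        using inj unfolding line_0 unfolding line_def by (auto simp: inj_eq)
      hence "u = (c - d) * v" "c - d \<in> K" using K by (auto simp: algebra_simps intro: is_subfield_diff)
      thus False using sym[OF uv] unfolding indep_def by blast
    qed
    thus ?thesis using eq sr by auto
  qed
  have indep_add: "f (u + v) = f u + f v" if uv: "indep u v" for u v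
  proof -
    obtain r where r: "r \<in> K" "f (u + v) = f u + r * f v" using half[OF uv] by blast
    obtain r' where r': "r' \<in> K" "f (u + v) = f v + r' * f u"
      using half[OF sym[OF uv]] by (auto simp: add.commute)
    \<comment> \<open>Exchanging \<open>u\<close> and \<open>v\<close> gave a second expansion;
      independence of \<open>f u\<close> and \<open>f v\<close> then forces
      \<open>r = 1\<close>.\<close>
    have "(1 - r) * f v = (1 - r') * f u" using r r' by (simp add: algebra_simps)
    moreover have "f v \<noteq> ((1 - r') / (1 - r)) * f u"
      using indep_f[OF uv] K r r' unfolding indep_def by (blast intro: is_subfield_intros)
    ultimately have "1 - r = 0" by (metis nonzero_mult_div_cancel_left times_divide_eq_left)
    thus ?thesis using r by simp
  qed
  show ?thesis
  proof (cases "u = 0 \<or> v = 0 \<or> indep u v")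
    case True thus ?thesis using f0 indep_add by auto
  next
    case False
    then obtain c where c: "c \<in> K" "v = c * u" and nz: "u \<noteq> 0" "v \<noteq> 0" unfolding indep_def by blast
    obtain z where z: "z \<notin> K" using proper by blast
    define w where "w = z * u"
    \<comment> \<open>As \<open>z\<close> lies outside \<open>K\<close>, adding \<open>w\<close> to
      any \<open>K\<close>-multiple of \<open>u\<close> gives a vector independent of
      \<open>u\<close>.\<close>
    have ind: "indep (a * u) (b * u + w)" if "a \<in> K" "b \<in> K" "a \<noteq> 0" for a b
      unfolding indep_def
    proof (intro conjI ballI notI)
      assume "a * u = 0" thus False using that nz by simp
    next
      fix s assume s: "s \<in> K" "b * u + w = s * (a * u)"
      hence "z * u = (s * a - b) * u" unfolding w_def by (simp add: algebra_simps)
      hence "z = s * a - b" using nz by simp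
      thus False using z s(1) that K by (auto intro: is_subfield_intros)
    qed
    have c0: "c \<noteq> 0" using c nz by auto
    have K01: "0 \<in> K" "1 \<in> K" "1 + c \<in> K" using K c by (auto intro: is_subfield_intros)
    have uv: "u + v = (1 + c) * u" unfolding c by (simp add: algebra_simps)
    have "f (u + v) + f w = f ((u + v) + w)"
    proof (cases "1 + c = 0")
      case True thus ?thesis using uv f0 by simp
    next
      case False thus ?thesis using indep_add[OF ind[of "1 + c" 0]] K01 uv by simp
    qed
    also have "\<dots> = f (u + (v + w))" by (simp add: add.assoc)
    also have "\<dots> = f u + f (v + w)" using indep_add[OF ind[of 1 c]] K01 c by simp
    also have "f (v + w) = f v + f w" using indep_add[OF ind[of c 0]] K01 c c0 by simp
    finally show ?thesis by (simp add: add.assoc[symmetric])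
  qed
qed

subsection \<open>Groups between the projective semilinear and the symmetric group\<close>

abbreviation proj_line :: "'a set \<Rightarrow> 'a option set" where
  "proj_line K \<equiv> insert None (Some ` K)"

text \<open>Transitivity of \<open>PGL_2(K)\<close> on triples of distinct points. The entries are
  kept in \<open>K\<close> because the lemma also serves for the subfield
  \<open>orbit_finite_elems\<close>.\<close>

lemma ex_frac_linear:
  assumes K: "is_subfield K" and "p \<in> proj_line K" "q \<in> proj_line K" "r \<in> proj_line K" "distinct [p, q, r]"
  obtains a b c d where "a \<in> K" "b \<in> K" "c \<in> K" "d \<in> K" "a * d - b * c \<noteq> 0"
    "frac_linear a b c d None = p" "frac_linear a b c d (Some 0) = q" "frac_linear a b c d (Some 1) = r"
proof -
  note sub [intro] = is_subfield_intros[OF K]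
  show thesis
  proof (cases p)
    case None
    then obtain b c where "q = Some b" "r = Some c" "b \<in> K" "c \<in> K" "b \<noteq> c" using assms by auto
    thus thesis using None by (intro that[of "c - b" b 0 1]) auto
  next
    case (Some a)
    hence a: "a \<in> K" using assms by auto
    show thesis
    proof (cases q)
      case None
      then obtain c where "r = Some c" "c \<in> K" "c \<noteq> a" using assms Some by auto
      thus thesis using Some None a by (intro that[of a "c - a" 1 0]) auto
    next
      case q: (Some b)
      hence b: "b \<in> K" "a \<noteq> b" using assms Some by auto
      show thesis
      proof (cases r)
        case None
        have "0 - b \<in> K" "0 - 1 \<in> K" using b by blast+
        thus thesis using Some q None a b by (intro that[of a "- b" 1 "- 1"]) (auto simp: algebra_simps)
      next
        case r: (Some c)
        hence c: "c \<in> K" "c \<noteq> a" "c \<noteq> b" using assms Some q by auto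
        \<comment> \<open>Columns proportional to \<open>(a, 1)\<close> and \<open>(b, 1)\<close>
          send infinity to \<open>a\<close> and 0 to \<open>b\<close>; the factors
          \<open>c - b\<close> and \<open>a - c\<close> are chosen to send 1 to
          \<open>c\<close>.\<close>
        have "a * (c - b) * (a - c) - b * (a - c) * (c - b) = (a - b) * (c - b) * (a - c)"
          by (simp add: algebra_simps)
        also have "\<dots> \<noteq> 0" using b c by simp
        finally have det: "a * (c - b) * (a - c) - b * (a - c) * (c - b) \<noteq> 0" .
        have "a * (c - b) + b * (a - c) = c * (a - b)" "(c - b) + (a - c) = a - b"
          by (simp_all add: algebra_simps)
        hence "(a * (c - b) + b * (a - c)) / ((c - b) + (a - c)) = c" using b by simp
        thus thesis using Some q r a b c det
          by (intro that[of "a * (c - b)" "b * (a - c)" "c - b" "a - c"]) auto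
      qed
    qed
  qed
qed

lemma frac_linear_proj_line:
  assumes "is_subfield K" "a \<in> K" "b \<in> K" "c \<in> K" "d \<in> K" "p \<in> proj_line K"
  shows "frac_linear a b c d p \<in> proj_line K"
  using assms(6) is_subfield_intros[OF assms(1)] assms(2-5) by (cases p) auto

text \<open>The inclusion is not strict, so that \<open>H = PGammaL2\<close> can be a conclusion;
  \<open>x\<close> is the fourth point of the generic quadruple.\<close>

locale projective_overgroup =
  fixes H :: "('a::alg_closed_field option \<Rightarrow> 'a option) set" and x :: 'a
  assumes subgroup: "subgroup H (BijGroup UNIV)"
    and PGammaL2_subset: "PGammaL2 \<subseteq> H"
    and transcendental: "\<not> algebraic_over prime_field x"
begin

section \<open>Composition and inversion in \<open>H\<close>\<close>

lemma H_Bij: "h \<in> H \<Longrightarrow> h \<in> Bij UNIV"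
  using subgroup.subset[OF subgroup] unfolding BijGroup_def by auto

lemma H_bij: "h \<in> H \<Longrightarrow> bij h"
  using H_Bij unfolding Bij_def by blast

lemma H_comp: "h \<in> H \<Longrightarrow> k \<in> H \<Longrightarrow> h \<circ> k \<in> H"
  using subgroup.m_closed[OF subgroup, of h k] H_Bij[of h] H_Bij[of k]
  unfolding BijGroup_def by (simp add: compose_def comp_def restrict_UNIV)

lemma H_inv: "h \<in> H \<Longrightarrow> inv_into UNIV h \<in> H"
  using subgroup.m_inv_closed[OF subgroup, of h] inv_BijGroup[OF H_Bij] by (simp add: restrict_UNIV)

lemma H_inv_apply: "h \<in> H \<Longrightarrow> inv_into UNIV h (h p) = p" "h \<in> H \<Longrightarrow> h (inv_into UNIV h p) = p"
  using H_bij by (simp_all add: bij_is_inj bij_is_surj surj_f_inv_f)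

lemma frac_linear_in_H: "a * d - b * c \<noteq> 0 \<Longrightarrow> frac_linear a b c d \<in> H"
proof -
  assume "a * d - b * c \<noteq> 0"
  moreover have "field_automorphism (id :: 'a \<Rightarrow> 'a)" unfolding field_automorphism_def by simp
  ultimately have "frac_linear a b c d \<circ> map_option id \<in> PGammaL2" unfolding PGammaL2_def by blast
  thus ?thesis using PGammaL2_subset by (auto simp: option.map_id0)
qed

lemma automorphism_in_H: "field_automorphism \<sigma> \<Longrightarrow> map_option \<sigma> \<in> H"
proof -
  assume \<sigma>: "field_automorphism \<sigma>"
  have "frac_linear 1 0 0 1 \<circ> map_option \<sigma> = map_option \<sigma>"
  proof
    fix p show "(frac_linear 1 0 0 1 \<circ> map_option \<sigma>) p = map_option \<sigma> p" by (cases p) auto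
  qed
  moreover have "frac_linear 1 0 0 1 \<circ> map_option \<sigma> \<in> PGammaL2"
    unfolding PGammaL2_def using \<sigma>
    by (intro CollectI exI[of _ 1] exI[of _ 0] exI[of _ \<sigma>]) simp
  ultimately show ?thesis using PGammaL2_subset by auto
qed

text \<open>
  The special quadruples are the ones whose \<open>H\<close>-orbit is not the generic one. Invariance under \<open>H\<close>
  and the transitivity of the automorphism group on transcendental elements give them a cross ratio
  that is algebraic over the prime field.
\<close>

definition special :: "'a option \<Rightarrow> 'a option \<Rightarrow> 'a option \<Rightarrow> 'a option \<Rightarrow> bool" where
  "special a b c d \<longleftrightarrow> distinct [a, b, c, d] \<and>
     \<not> (\<exists>h\<in>H. h None = a \<and> h (Some 0) = b \<and> h (Some 1) = c \<and> h (Some x) = d)"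

text \<open>If \<open>k\<close> carried the generic quadruple to the image, \<open>k\<close>
  followed by the inverse of \<open>h\<close> would carry it to the original one.\<close>

lemma special_image:
  assumes "h \<in> H" "special a b c d"
  shows "special (h a) (h b) (h c) (h d)"
  unfolding special_def
proof (intro conjI notI)
  show "distinct [h a, h b, h c, h d]"
    using assms(2) H_bij[OF assms(1)] unfolding special_def by (auto simp: bij_def inj_eq)
  assume "\<exists>k\<in>H. k None = h a \<and> k (Some 0) = h b \<and> k (Some 1) = h c \<and> k (Some x) = h d"
  then obtain k where "k \<in> H" "k None = h a" "k (Some 0) = h b" "k (Some 1) = h c" "k (Some x) = h d"
    by blast
  hence "inv_into UNIV h \<circ> k \<in> H" "(inv_into UNIV h \<circ> k) None = a" "(inv_into UNIV h \<circ> k) (Some 0) = b"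
    "(inv_into UNIV h \<circ> k) (Some 1) = c" "(inv_into UNIV h \<circ> k) (Some x) = d"
    using H_comp[OF H_inv] H_inv_apply(1) assms(1) by simp_all
  thus False using assms(2) unfolding special_def by blast
qed

inductive_set special_closure for S where
  base: "p \<in> S \<Longrightarrow> p \<in> special_closure S"
| step: "a \<in> special_closure S \<Longrightarrow> b \<in> special_closure S \<Longrightarrow> c \<in> special_closure S \<Longrightarrow>
    special a b c d \<Longrightarrow> d \<in> special_closure S"

text \<open>The generating rule is invariant under \<open>H\<close>, so \<open>h\<close> carries a
  derivation of \<open>p\<close> to one of \<open>h p\<close>.\<close>

lemma special_closure_image:
  assumes "h \<in> H" "p \<in> special_closure S" "h ` S \<subseteq> special_closure T"
  shows "h p \<in> special_closure T"
  using assms(2)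
proof induction
  case (base p) thus ?case using assms(3) by blast
next
  case (step a b c d)
  thus ?case using special_closure.step special_image[OF assms(1)] by blast
qed

section \<open>The subline generated by infinity, 0 and 1, and its coordinates\<close>

definition L :: "'a option set" where
  "L = special_closure {None, Some 0, Some 1}"

definition k0 :: "'a set" where
  "k0 = {s. Some s \<in> L}"

lemma in_L: "None \<in> L" "Some 0 \<in> L" "Some 1 \<in> L"
  unfolding L_def by (auto intro: special_closure.base)

lemma in_k0: "0 \<in> k0" "1 \<in> k0"
  unfolding k0_def using in_L by auto

text \<open>Applied to fractional linear maps this yields the field operations on \<open>k0\<close>;
  applied to other elements of \<open>H\<close> it yields the preservation of
  \<open>k0\<close>-lines.\<close>

lemma L_image:
  assumes "h \<in> H" "h None \<in> L" "h (Some 0) \<in> L" "h (Some 1) \<in> L" "p \<in> L"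
  shows "h p \<in> L"
  using special_closure_image[OF assms(1), of p "{None, Some 0, Some 1}" "{None, Some 0, Some 1}"] assms(2-5)
  unfolding L_def by blast

text \<open>A transcendental fourth point is the image of \<open>x\<close> under an automorphism,
  which fixes infinity, 0 and 1; the quadruple would then be generic.\<close>

lemma orbit_finite_special:
  assumes "special None (Some 0) (Some 1) p"
  shows "p \<in> proj_line orbit_finite_elems"
proof (cases p)
  case (Some e)
  have "e \<in> orbit_finite_elems"
  proof (rule ccontr)
    assume "e \<notin> orbit_finite_elems"
    hence "\<not> algebraic_over prime_field e" using algebraic_orbit_finite by blast
    then obtain \<sigma> where \<sigma>: "field_automorphism \<sigma>" "\<sigma> x = e"
      using ex_automorphism_transcendental[OF is_subring_prime_field transcendental] by blast
    hence "map_option \<sigma> None = None" "map_option \<sigma> (Some 0) = Some 0"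
      "map_option \<sigma> (Some 1) = Some 1" "map_option \<sigma> (Some x) = p"
      using Some field_automorphism_0[OF \<sigma>(1)] by (auto simp: field_automorphism_def)
    thus False using assms automorphism_in_H[OF \<sigma>(1)] unfolding special_def by blast
  qed
  thus ?thesis using Some by blast
qed simp

text \<open>Three points over the subfield are normalized to infinity, 0, 1 by a fractional linear
  map over it, so the new point is again over the subfield.\<close>

lemma L_subset: "L \<subseteq> proj_line orbit_finite_elems"
proof
  note k = is_subfield_orbit_finite_elems
  fix p assume "p \<in> L"
  thus "p \<in> proj_line orbit_finite_elems"
    unfolding L_def
  proof induction
    case (base p) thus ?case using k unfolding is_subfield_def by blast
  next
    case (step a b c d)
    have "distinct [a, b, c]" using step.hyps(4) unfolding special_def by auto
    from ex_frac_linear[OF k step.IH this]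
    obtain A B C D where co: "A \<in> orbit_finite_elems" "B \<in> orbit_finite_elems" "C \<in> orbit_finite_elems"
      "D \<in> orbit_finite_elems" and nz: "A * D - B * C \<noteq> 0"
      and g: "frac_linear A B C D None = a" "frac_linear A B C D (Some 0) = b" "frac_linear A B C D (Some 1) = c"
      by blast
    let ?g = "frac_linear A B C D"
    have H: "?g \<in> H" using nz by (rule frac_linear_in_H)
    have "special (inv_into UNIV ?g a) (inv_into UNIV ?g b) (inv_into UNIV ?g c) (inv_into UNIV ?g d)"
      using special_image[OF H_inv[OF H] step.hyps(4)] .
    hence "special None (Some 0) (Some 1) (inv_into UNIV ?g d)"
      using g H_inv_apply(1)[OF H] by metis
    hence "inv_into UNIV ?g d \<in> proj_line orbit_finite_elems" by (rule orbit_finite_special)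
    thus ?case using frac_linear_proj_line[OF k co] H_inv_apply(2)[OF H] by metis
  qed
qed

lemma k0_proper: "k0 \<noteq> UNIV"
  using L_subset transcendental_not_orbit_finite[OF transcendental] unfolding k0_def by blast

text \<open>The map \<open>z \<mapsto> b + (c - b) * z\<close> sends infinity, 0, 1 to infinity,
  \<open>b\<close>, \<open>c\<close>.\<close>

lemma k0_affine:
  assumes "b \<in> k0" "c \<in> k0" "s \<in> k0"
  shows "b + (c - b) * s \<in> k0"
proof (cases "b = c")
  case False
  hence "frac_linear (c - b) b 0 1 \<in> H" by (intro frac_linear_in_H) simp
  from L_image[OF this, of "Some s"] assms in_L show ?thesis
    unfolding k0_def by (simp add: add.commute)
qed (use assms in simp)

lemma k0_mult:
  assumes "a \<in> k0" "b \<in> k0"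
  shows "a * b \<in> k0"
  using k0_affine[OF in_k0(1) assms] by simp

text \<open>Inversion permutes infinity, 0 and 1.\<close>

lemma k0_inverse:
  assumes "a \<in> k0"
  shows "inverse a \<in> k0"
proof (cases "a = 0")
  case False
  have "frac_linear 0 1 1 0 \<in> H" by (intro frac_linear_in_H) simp
  from L_image[OF this, of "Some a"] assms in_L False show ?thesis
    unfolding k0_def by (simp add: inverse_eq_divide)
qed (use assms in simp)

text \<open>Products, inverses and \<open>1 - s\<close> are available. The third element
  \<open>t\<close> yields \<open>- 1\<close>, and sums are then \<open>a * (1 - (- b / a))\<close>.
  The set of 0 and 1 alone is closed under the same operations but is no field unless the
  characteristic is 2.\<close>

lemma k0_subfield:
  assumes t: "t \<in> k0" "t \<noteq> 0" "t \<noteq> 1"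
  shows "is_subfield k0"
proof -
  have one_minus: "1 - s \<in> k0" if "s \<in> k0" for s
    using k0_affine[OF in_k0(2,1) that] by simp
  have "inverse (1 - inverse t) * inverse t * (1 - t) \<in> k0"
    using t(1) by (intro k0_mult k0_inverse one_minus)
  moreover have "inverse (1 - inverse t) * inverse t * (1 - t) = - 1"
  proof -
    have "inverse (1 - inverse t) * inverse t = inverse (t - 1)"
      using t(2) by (simp add: inverse_mult_distrib[symmetric] algebra_simps)
    hence "inverse (1 - inverse t) * inverse t * (1 - t) = - (inverse (t - 1) * (t - 1))"
      by (simp add: algebra_simps)
    thus ?thesis using t(3) by simp
  qed
  ultimately have m1: "- 1 \<in> k0" by simp
  have minus: "- a \<in> k0" if "a \<in> k0" for a using k0_mult[OF m1 that] by simp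
  have "a + b \<in> k0" if "a \<in> k0" "b \<in> k0" for a b
  proof (cases "a = 0")
    case False
    have "a * (1 - (- b * inverse a)) \<in> k0"
      using that by (intro k0_mult one_minus minus k0_inverse)
    moreover have "a * (1 - (- b * inverse a)) = a + b" using False by (simp add: algebra_simps)
    ultimately show ?thesis by simp
  qed (use that in simp)
  thus ?thesis unfolding is_subfield_def by (simp add: in_k0 minus k0_mult k0_inverse)
qed

text \<open>The affine maps \<open>?m\<close> and \<open>?n\<close> carry 0, 1 to \<open>a\<close>,
  \<open>b\<close> and to \<open>f a\<close>, \<open>f b\<close>. Normalized by them,
  \<open>h\<close> fixes infinity, 0 and 1 and hence maps \<open>L\<close> into itself, while
  \<open>?m\<close> carries \<open>k0\<close> onto the line through \<open>a\<close> and
  \<open>b\<close>.\<close>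

lemma line_image_subset:
  assumes h: "h \<in> H" "h None = None" and f: "\<And>z. h (Some z) = Some (f z)"
  shows "f ` line k0 a b \<subseteq> line k0 (f a) (f b)"
proof (cases "a = b")
  case True thus ?thesis using in_k0 unfolding line_def by auto
next
  case False
  have "f a \<noteq> f b" using False f H_bij[OF h(1)] by (metis bij_pointE option.inject)
  let ?m = "frac_linear (b - a) a 0 1" and ?n = "frac_linear (f b - f a) (f a) 0 1"
  have m: "?m \<in> H" "?n \<in> H" using False \<open>f a \<noteq> f b\<close> by (auto intro!: frac_linear_in_H)
  let ?h = "inv_into UNIV ?n \<circ> (h \<circ> ?m)"
  have hH: "?h \<in> H" using m h by (intro H_comp H_inv)
  have n: "inv_into UNIV ?n None = None" "inv_into UNIV ?n (Some (f a)) = Some 0" "inv_into UNIV ?n (Some (f b)) = Some 1"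
    using H_inv_apply(1)[OF m(2), of None] H_inv_apply(1)[OF m(2), of "Some 0"]
      H_inv_apply(1)[OF m(2), of "Some 1"] by simp_all
  have fixed: "?h None = None" "?h (Some 0) = Some 0" "?h (Some 1) = Some 1"
    using n h(2) f by simp_all
  show ?thesis
  proof
    fix z assume "z \<in> f ` line k0 a b"
    then obtain s where s: "s \<in> k0" "z = f (a + (b - a) * s)" unfolding line_def by blast
    have "?h (Some s) \<in> L"
      by (rule L_image[OF hH]) (use fixed in_L s in \<open>simp_all only: k0_def mem_Collect_eq\<close>)
    moreover have "?h (Some s) \<noteq> None" using fixed(1) H_bij[OF hH] by (metis bij_pointE option.distinct(1))
    ultimately obtain s' where s': "s' \<in> k0" "?h (Some s) = Some s'" unfolding k0_def by auto
    have "?n (Some s') = ?n (inv_into UNIV ?n (h (?m (Some s))))" using s'(2) by simp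
    also have "\<dots> = h (?m (Some s))" by (rule H_inv_apply(2)[OF m(2)])
    finally have "z = f a + (f b - f a) * s'" using s f by (simp add: add.commute)
    thus "z \<in> line k0 (f a) (f b)" using s' unfolding line_def by blast
  qed
qed

text \<open>Applying the line inclusion to \<open>h\<close> and to its inverse shows that lines are
  mapped onto lines.\<close>

lemma stabilizer_additive:
  assumes t: "t \<in> k0" "t \<noteq> 0" "t \<noteq> 1"
    and h: "h \<in> H" "h None = None" "h (Some 0) = Some 0" and f: "\<And>z. h (Some z) = Some (f z)"
  shows "f (u + v) = f u + f v"
proof (rule line_preserving_additive[OF k0_subfield[OF t] t k0_proper])
  show inj: "inj f" using f H_bij[OF h(1)] by (metis bij_pointE injI option.inject)
  show "f 0 = 0" using f h(3) by simp
  have surj: "surj f"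
    unfolding surj_def
  proof
    fix z
    have "h (inv_into UNIV h (Some z)) = Some z" using H_inv_apply(2)[OF h(1)] .
    moreover have "inv_into UNIV h (Some z) \<noteq> None"
    proof
      assume "inv_into UNIV h (Some z) = None"
      with calculation h(2) show False by simp
    qed
    ultimately show "\<exists>y. z = f y" using f by (metis not_None_eq option.inject)
  qed
  have inv: "inv_into UNIV h None = None" "inv_into UNIV h (Some z) = Some (inv_into UNIV f z)" for z
    using H_inv_apply(1)[OF h(1), of None] H_inv_apply(1)[OF h(1), of "Some (inv_into UNIV f z)"] h(2) f
      surj_f_inv_f[OF surj] by simp_all
  fix a b
  have "inv_into UNIV f ` line k0 (f a) (f b) \<subseteq> line k0 a b"
    using line_image_subset[OF H_inv[OF h(1)] inv, of "f a" "f b"] inj by simp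
  hence "f ` inv_into UNIV f ` line k0 (f a) (f b) \<subseteq> f ` line k0 a b" by blast
  thus "f ` line k0 a b = line k0 (f a) (f b)"
    using line_image_subset[OF h(1,2) f, of a b] surj by (simp add: image_f_inv_f subset_antisym)
qed

text \<open>Conjugating \<open>h\<close> by \<open>z \<mapsto> 1 / z\<close> again gives an element
  of \<open>H\<close> fixing infinity and 0, so \<open>f\<close> and its conjugate are both
  additive.\<close>

lemma stabilizer_automorphism:
  assumes t: "t \<in> k0" "t \<noteq> 0" "t \<noteq> 1"
    and h: "h \<in> H" "h None = None" "h (Some 0) = Some 0" "h (Some 1) = Some 1"
  obtains \<sigma> where "field_automorphism \<sigma>" "h = map_option \<sigma>"
proof -
  have "\<exists>y. h (Some z) = Some y" for z
    using h(2) H_bij[OF h(1)] by (metis bij_pointE not_None_eq option.distinct(1))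
  then obtain f where f: "\<And>z. h (Some z) = Some (f z)" by metis
  let ?J = "frac_linear 0 1 1 0 :: 'a option \<Rightarrow> 'a option"
  let ?k = "?J \<circ> (h \<circ> ?J)"
  have J: "?J \<in> H" by (intro frac_linear_in_H) simp
  have kH: "?k \<in> H" using J h by (intro H_comp)
  have f01: "f 0 = 0" "f 1 = 1" using f h by auto
  have hf: "h = map_option f"
  proof
    fix p show "h p = map_option f p" using h(2) f by (cases p) auto
  qed
  have bij: "bij f"
  proof (rule bijI)
    show "inj f" using f H_bij[OF h(1)] by (metis bij_pointE injI option.inject)
    show "surj f"
      unfolding surj_def
    proof
      fix z
      have "h (inv_into UNIV h (Some z)) = Some z" using H_inv_apply(2)[OF h(1)] .
      thus "\<exists>y. z = f y" unfolding hf by (cases "inv_into UNIV (map_option f) (Some z)") auto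
    qed
  qed
  have fz: "f z = 0 \<longleftrightarrow> z = 0" for z using bij f01 by (metis bij_pointE)
  \<comment> \<open>At \<open>z = 0\<close> the convention \<open>inverse 0 = 0\<close> agrees with
    \<open>?k\<close>, which fixes 0 by passing through infinity.\<close>
  have k: "?k (Some z) = Some (inverse (f (inverse z)))" for z
    using h(2) f f01 fz by (cases "z = 0") (auto simp: inverse_eq_divide)
  have "field_automorphism f"
  proof (rule additive_inverse_field_automorphism[OF bij f01(2) _ refl])
    show "f (a + b) = f a + f b" for a b
      using stabilizer_additive[OF t h(1-3) f] .
    show "inverse (f (inverse (a + b))) = inverse (f (inverse a)) + inverse (f (inverse b))" for a b
      by (rule stabilizer_additive[OF t kH _ _ k]) (use h in auto)
  qed
  thus thesis using that hf by blast
qed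

text \<open>A fractional linear map agreeing with \<open>h\<close> at infinity, 0 and 1 reduces the
  claim to the stabilizer of these three points.\<close>

lemma overgroup_eq:
  assumes t: "t \<in> k0" "t \<noteq> 0" "t \<noteq> 1"
  shows "H = PGammaL2"
proof
  show "H \<subseteq> PGammaL2"
  proof
    fix h assume h: "h \<in> H"
    have "is_subfield (UNIV :: 'a set)" unfolding is_subfield_def by blast
    moreover have "distinct [h None, h (Some 0), h (Some 1)]"
      using H_bij[OF h] by (auto simp: bij_def inj_eq)
    moreover have "p \<in> proj_line UNIV" for p :: "'a option" by (cases p) auto
    ultimately obtain a b c d where nz: "a * d - b * c \<noteq> 0"
      and g: "frac_linear a b c d None = h None" "frac_linear a b c d (Some 0) = h (Some 0)"
        "frac_linear a b c d (Some 1) = h (Some 1)"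
      using ex_frac_linear[of UNIV "h None" "h (Some 0)" "h (Some 1)"] by metis
    let ?g = "frac_linear a b c d"
    have gH: "?g \<in> H" using nz by (rule frac_linear_in_H)
    have "inv_into UNIV ?g \<circ> h \<in> H" using H_comp[OF H_inv[OF gH] h] .
    moreover have "(inv_into UNIV ?g \<circ> h) None = None" "(inv_into UNIV ?g \<circ> h) (Some 0) = Some 0" "(inv_into UNIV ?g \<circ> h) (Some 1) = Some 1"
      unfolding comp_def g[symmetric] by (rule H_inv_apply(1)[OF gH])+
    ultimately obtain \<sigma> where \<sigma>: "field_automorphism \<sigma>" "inv_into UNIV ?g \<circ> h = map_option \<sigma>"
      using stabilizer_automorphism[OF t] by metis
    have "h = ?g \<circ> (inv_into UNIV ?g \<circ> h)" using H_inv_apply(2)[OF gH] by (simp add: fun_eq_iff)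
    hence "h = ?g \<circ> map_option \<sigma>" using \<sigma>(2) by simp
    thus "h \<in> PGammaL2" unfolding PGammaL2_def using nz \<sigma>(1) by blast
  qed
qed (rule PGammaL2_subset)

text \<open>Every quadruple of distinct points lies in the orbit of the generic one, so any two are
  linked through it.\<close>

lemma four_transitive:
  assumes none: "\<And>a b c d. \<not> special a b c d"
  shows "k_transitive 4 H"
proof -
  have ex: "\<exists>h\<in>H. map h [None, Some 0, Some 1, Some x] = ys" if ys: "length ys = 4" "distinct ys" for ys
  proof -
    obtain a b c d where abcd: "ys = [a, b, c, d]"
      using ys(1) by (auto simp: numeral_eq_Suc length_Suc_conv)
    thus ?thesis using none[of a b c d] ys(2) unfolding special_def by auto
  qed
  show ?thesis
    unfolding k_transitive_def
  proof (intro allI impI)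
    fix xs ys :: "'a option list"
    assume *: "length xs = 4 \<and> distinct xs \<and> length ys = 4 \<and> distinct ys"
    obtain g h where gh: "g \<in> H" "map g [None, Some 0, Some 1, Some x] = xs"
      "h \<in> H" "map h [None, Some 0, Some 1, Some x] = ys"
      using ex * by metis
    have "map (h \<circ> inv_into UNIV g) xs = ys"
      unfolding gh(2,4)[symmetric] using H_inv_apply(1)[OF gh(1)] by simp
    thus "\<exists>h\<in>H. map h xs = ys" using H_comp[OF gh(3) H_inv[OF gh(1)]] by blast
  qed
qed

text \<open>Once the first three points are moved to infinity, 0 and 1, the closure rule puts the
  fourth into \<open>L\<close>, and distinctness makes its coordinate new.\<close>

lemma special_imp_k0:
  assumes s: "special a b c d"
  obtains t where "t \<in> k0" "t \<noteq> 0" "t \<noteq> 1"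
proof -
  have "is_subfield (UNIV :: 'a set)" unfolding is_subfield_def by blast
  moreover have "distinct [a, b, c]" using s unfolding special_def by auto
  moreover have "p \<in> proj_line UNIV" for p :: "'a option" by (cases p) auto
  ultimately obtain A B C D where nz: "A * D - B * C \<noteq> 0"
    and g: "frac_linear A B C D None = a" "frac_linear A B C D (Some 0) = b" "frac_linear A B C D (Some 1) = c"
    using ex_frac_linear[of UNIV a b c] by metis
  let ?g = "frac_linear A B C D"
  have gH: "?g \<in> H" using nz by (rule frac_linear_in_H)
  have "special (inv_into UNIV ?g a) (inv_into UNIV ?g b) (inv_into UNIV ?g c) (inv_into UNIV ?g d)"
    using special_image[OF H_inv[OF gH] s] .
  hence sp: "special None (Some 0) (Some 1) (inv_into UNIV ?g d)"
    using g H_inv_apply(1)[OF gH] by metis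
  then obtain t where t: "inv_into UNIV ?g d = Some t" unfolding special_def by (cases "inv_into UNIV ?g d") auto
  have "t \<noteq> 0" "t \<noteq> 1" using sp t unfolding special_def by auto
  moreover have "t \<in> k0"
    using special_closure.step[OF _ _ _ sp] in_L t unfolding k0_def L_def by auto
  ultimately show thesis using that by blast
qed

end

theorem theorem3p2:
  fixes H :: "('a::alg_closed_field option \<Rightarrow> 'a option) set"
  assumes "1 \<le> transcendence_degree (prime_field :: 'a set)"
    and "subgroup H (BijGroup UNIV)"
    and "PGammaL2 \<subset> H"
  shows "k_transitive 4 H"
proof -
  obtain x :: 'a where x: "\<not> algebraic_over prime_field x"
    using ex_transcendental[OF assms(1)] is_subring_0[OF is_subring_prime_field] by blast
  interpret projective_overgroup H x
    using assms x by (intro projective_overgroup.intro) auto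
  show ?thesis
  proof (rule four_transitive, rule notI)
    \<comment> \<open>A special quadruple collapses \<open>H\<close> to \<open>PGammaL2\<close>,
      against the strict inclusion.\<close>
    fix a b c d assume "special a b c d"
    then obtain t where "t \<in> k0" "t \<noteq> 0" "t \<noteq> 1" by (rule special_imp_k0)
    thus False using overgroup_eq assms(3) by blast
  qed
qed

end
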